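(* Let $n\ge1$ and let $\xi_1,\ldots,\xi_n$ be i.i.d. random variables with mean zero and with variances summing to one, i.e. $\sum_{i=1}^n\mathbb{E}\,\xi_i^2=1$. Let $W=\sum_{i=1}^n\xi_i$ and let $$\beta_2=\sum_{i=1}^n\mathbb{E}\left[\xi_i^2\,\mathbf{1}(|\xi_i|>1)\right],\qquad \beta_3=\sum_{i=1}^n\mathbb{E}\left[|\xi_i|^3\,\mathbf{1}(|\xi_i|\le1)\right].$$ Then for all $z\in\mathbb{R}$, $$|\mathbb{P}(W\le z)-\Phi(z)|\le 2\sum_{i=1}^n\mathbb{P}\left(|\xi_i|>\frac{1\vee|z|}{4}\right)+C_2(1+|z|)^{-2}(\beta_2+\beta_3),$$ where $$C_2\le\begin{cases}15&\text{if }\beta_2+\beta_3\ge1;\\ 37&\text{if }\beta_2+\beta_3<1\text{ and }|z|\le2;\\ 25431&\text{if }\beta_2+\beta_3<1\text{ and }|z|>2.\end{cases}$$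
   Context: $\Phi$ denotes the cumulative distribution function of the standard normal distribution; $a\vee b=\max(a,b)$; $\mathbf{1}(A)$ is the indicator of $A$. The statement about $C_2$ means that the inequality holds with some $C_2$ satisfying the displayed upper bound in each case (equivalently, with $C_2$ equal to that upper bound). *)

theory Defs
  imports "HOL-Probability.Probability"
begin

definition trunc_beta2 :: "'a measure \<Rightarrow> (nat \<Rightarrow> 'a \<Rightarrow> real) \<Rightarrow> nat \<Rightarrow> real" where
  "trunc_beta2 M \<xi> n =
     (\<Sum>i=1..n. LINT \<omega>|M. (\<xi> i \<omega>)\<^sup>2 * indicat_real {\<omega>. \<bar>\<xi> i \<omega>\<bar> > 1} \<omega>)"

definition trunc_beta3 :: "'a measure \<Rightarrow> (nat \<Rightarrow> 'a \<Rightarrow> real) \<Rightarrow> nat \<Rightarrow> real" where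
  "trunc_beta3 M \<xi> n =
     (\<Sum>i=1..n. LINT \<omega>|M. \<bar>\<xi> i \<omega>\<bar> ^ 3 * indicat_real {\<omega>. \<bar>\<xi> i \<omega>\<bar> \<le> 1} \<omega>)"

(* The argument b stands for beta_2 + beta_3. *)
definition C2_bound :: "real \<Rightarrow> real \<Rightarrow> real" where
  "C2_bound b z = (if b \<ge> 1 then 15 else if \<bar>z\<bar> \<le> 2 then 37 else 25431)"

end

theory Submission
  imports Defs
begin

text \<open>The proof is Fourier-analytic. Write \<open>D\<close> for the difference between the distribution function of \<open>W\<close>
and \<open>\<Phi>\<close>, and \<open>\<beta> = \<beta>\<^sub>2 + \<beta>\<^sub>3\<close>; all three cases are proved in the form
\<open>(1 + \<bar>z\<bar>)\<^sup>2 \<bar>D z\<bar> \<le> C\<^sub>2 \<beta>\<close>.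

If \<open>C\<^sub>2 \<beta> \<ge> 2\<close>, this follows from Cantelli's inequality alone (\<open>cdf_difference_trivial\<close>). That settles
\<open>\<beta> \<ge> 1\<close>, and in the two remaining cases it makes \<open>\<beta>\<close> small: less than \<open>2 / 37\<close> for \<open>\<bar>z\<bar> \<le> 2\<close> and less than
\<open>2 / 25431\<close> for \<open>\<bar>z\<bar> > 2\<close>.

For small \<open>\<beta>\<close> and \<open>\<bar>z\<bar> \<le> 2\<close> a uniform Berry-Esseen bound with constant \<open>37 / 9\<close> is enough. It comes from
Esseen's smoothing inequality with the Fejer kernel (\<open>fejer_smoothing_inequality\<close>), whose smoothed difference is
controlled by the characteristic functions on \<open>[0, T]\<close>, where \<open>T\<close> is a multiple of \<open>1 / \<beta>\<close>
(\<open>fejer_weighted_difference\<close>). The summands being identically distributed, \<open>W\<close> has characteristic function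
\<open>\<phi>\<^sup>n\<close>, and on this range \<open>\<phi>\<^sup>n\<close> is within \<open>O(t\<^sup>2 \<beta>\<^sub>2 + t\<^sup>3 \<beta>\<^sub>3)\<close>, times a Gaussian factor, of \<open>exp (- t\<^sup>2 / 2)\<close>.

For \<open>\<bar>z\<bar> > 2\<close> the decay in \<open>z\<close> is obtained by applying the same smoothing inequality to the measures
\<open>x\<^sup>2 dF\<close> and \<open>x\<^sup>2 d\<Phi>\<close>. Both are probability measures because both laws have variance one, and if their distribution
functions are uniformly within \<open>\<eta>\<close>, then \<open>\<bar>D z\<bar> \<le> 2 \<eta> / z\<^sup>2\<close>, since \<open>1 / w\<^sup>2\<close> is the integral of \<open>2 / s\<^sup>3\<close> over
\<open>s \<ge> \<bar>w\<bar>\<close> (\<open>cdf_difference_from_square_density\<close>). The transform of \<open>x\<^sup>2 dF\<close> is \<open>E (W\<^sup>2 exp (i t W))\<close>. Near \<open>t = 0\<close>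
it is not within \<open>O(t \<beta>)\<close> of its Gaussian counterpart, because only the second moment of a large summand is under
control. The part of \<open>W\<^sup>2\<close> that causes this is \<open>\<Sum>\<^sub>i \<xi>\<^sub>i\<^sup>2\<close> restricted to the summands with \<open>\<bar>\<xi>\<^sub>i\<bar> > 1\<close>;
it is nonnegative and has expectation \<open>\<beta>\<^sub>2\<close>, so it is split off before the Fourier transform is taken, at a cost of
at most \<open>\<beta>\<^sub>2\<close> (\<open>core_weight\<close>, \<open>tail_weight\<close>).\<close>

section \<open>The Fejer distribution\<close>

text \<open>The primitive of the Fejer kernel \<open>(1 - cos u) / (\<pi> u\<^sup>2)\<close>, in closed form. At \<open>u = 0\<close> the
quotient is \<open>0\<close>, which is also its continuous value.\<close>

definition fejer_cdf :: "real \<Rightarrow> real" where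
  "fejer_cdf u = 1 / 2 + (Si u - (1 - cos u) / u) / pi"

text \<open>Writing the derivative through \<open>sinc\<close> keeps the formula valid at \<open>u = 0\<close>, so that
no case distinction is needed later.\<close>

lemma DERIV_one_minus_cos_over:
  "((\<lambda>u. (1 - cos u) / u) has_real_derivative (sinc u - (sinc (u / 2))\<^sup>2 / 2)) (at u)"
proof (cases "u = 0")
  case True
  have cos_half: "1 - cos h = 2 * (sin (h / 2))\<^sup>2" for h :: real
    using cos_double_sin[of "h / 2"] by simp
  have "((\<lambda>h. (sinc (h / 2))\<^sup>2 / 2) \<longlongrightarrow> (sinc (0 / 2))\<^sup>2 / 2) (at 0)"
    by (intro tendsto_intros isCont_tendsto_compose[OF isCont_sinc]) auto
  then have "((\<lambda>h. (sinc (h / 2))\<^sup>2 / 2) \<longlongrightarrow> 1 / 2) (at 0)"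
    by simp
  then have "((\<lambda>h::real. (1 - cos (0 + h)) / (0 + h) / h) \<longlongrightarrow> 1 / 2) (at 0)"
    by (rule Lim_transform_eventually)
      (auto simp: eventually_at_filter cos_half power2_eq_square field_simps)
  then show ?thesis
    using True by (simp add: DERIV_def)
next
  case False
  have cos_half: "cos u = 1 - 2 * (sin (u / 2))\<^sup>2"
    using cos_double_sin[of "u / 2"] by simp
  have "((\<lambda>u. (1 - cos u) / u) has_real_derivative (sin u * u - (1 - cos u)) / (u * u)) (at u)"
    using False by (auto intro!: derivative_eq_intros)
  also have "(sin u * u - (1 - cos u)) / (u * u) = sinc u - (sinc (u / 2))\<^sup>2 / 2"
    using False unfolding cos_half by (simp add: field_simps power2_eq_square)
  finally show ?thesis .
qed

lemma DERIV_fejer_cdf: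
  "(fejer_cdf has_real_derivative (sinc (u / 2))\<^sup>2 / (2 * pi)) (at u)"
proof -
  have "((\<lambda>u. 1 / 2 + (Si u - (1 - cos u) / u) / pi) has_real_derivative
     0 + (sinc u - (sinc u - (sinc (u / 2))\<^sup>2 / 2)) / pi) (at u)"
    by (intro DERIV_add DERIV_const DERIV_cdivide DERIV_diff DERIV_Si DERIV_one_minus_cos_over)
  then show ?thesis
    by (simp add: fejer_cdf_def[abs_def] field_simps)
qed

lemma fejer_cdf_mono: "x \<le> y \<Longrightarrow> fejer_cdf x \<le> fejer_cdf y"
  by (rule DERIV_nonneg_imp_nondecreasing, assumption, intro exI conjI, rule DERIV_fejer_cdf)
    (simp del: split_paired_All)

lemma isCont_fejer_cdf: "isCont fejer_cdf u"
  by (rule DERIV_isCont[OF DERIV_fejer_cdf])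

lemma continuous_at_right_fejer_cdf: "continuous (at_right u) fejer_cdf"
  by (rule continuous_at_imp_continuous_within[OF isCont_fejer_cdf])

lemma borel_measurable_fejer_cdf [measurable]: "fejer_cdf \<in> borel_measurable borel"
  by (auto intro!: borel_measurable_continuous_onI continuous_at_imp_continuous_on isCont_fejer_cdf)

lemma fejer_cdf_minus: "fejer_cdf (- u) = 1 - fejer_cdf u"
proof -
  have "Si (- u) = - Si u"
    using Si_neg[of u] Si_neg[of "- u"] by (cases "u \<ge> 0") auto
  then show ?thesis
    by (simp add: fejer_cdf_def field_simps)
qed

lemma fejer_cdf_at_top: "(fejer_cdf \<longlongrightarrow> 1) at_top"
proof -
  have "((\<lambda>u::real. (1 - cos u) / u) \<longlongrightarrow> 0) at_top"
  proof (rule Lim_null_comparison)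
    show "\<forall>\<^sub>F u in at_top. norm ((1 - cos u) / u) \<le> 2 / (u::real)"
      using eventually_gt_at_top[of "0::real"]
    proof eventually_elim
      case (elim u)
      then show ?case
        using cos_ge_minus_one[of u] cos_le_one[of u] by (auto simp: divide_simps)
    qed
    show "((\<lambda>u::real. 2 / u) \<longlongrightarrow> 0) at_top"
      by (intro tendsto_divide_0[OF tendsto_const] filterlim_at_top_imp_at_infinity filterlim_ident)
  qed
  then have "(fejer_cdf \<longlongrightarrow> 1 / 2 + (pi / 2 - 0) / pi) at_top"
    unfolding fejer_cdf_def[abs_def] by (intro tendsto_intros Si_at_top) auto
  then show ?thesis
    by simp
qed

lemma fejer_cdf_at_bot: "(fejer_cdf \<longlongrightarrow> 0) at_bot"
proof -
  have "((\<lambda>u. 1 - fejer_cdf u) \<longlongrightarrow> 1 - 1) at_top"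
    by (intro tendsto_intros fejer_cdf_at_top)
  then have "((\<lambda>u. fejer_cdf (- u)) \<longlongrightarrow> 0) at_top"
    by (simp add: fejer_cdf_minus)
  then show ?thesis
    by (simp add: filterlim_at_bot_mirror)
qed

lemma fejer_cdf_bounds: "0 \<le> fejer_cdf u" "fejer_cdf u \<le> 1"
proof -
  show "fejer_cdf u \<le> 1"
    by (rule tendsto_lowerbound[OF fejer_cdf_at_top])
      (auto intro: eventually_mono[OF eventually_ge_at_top[of u]] fejer_cdf_mono)
  show "0 \<le> fejer_cdf u"
    by (rule tendsto_upperbound[OF fejer_cdf_at_bot])
      (auto intro: eventually_mono[OF eventually_le_at_bot[of u]] fejer_cdf_mono)
qed

text \<open>The kernel is at most \<open>2 / (\<pi> u\<^sup>2)\<close>, so \<open>fejer_cdf u + 2 / (\<pi> u)\<close> decreases to its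
limit \<open>1\<close>.\<close>

lemma fejer_cdf_tail:
  assumes "b > 0" shows "1 - fejer_cdf b \<le> 2 / (pi * b)"
proof -
  define G where "G u = fejer_cdf u + 2 / (pi * u)" for u
  have "G b \<ge> G x" if "x \<ge> b" for x
  proof (rule DERIV_nonpos_imp_nonincreasing[OF that])
    fix u assume "b \<le> u" "u \<le> x"
    then have u: "u > 0" using assms by simp
    have d: "(G has_real_derivative (sinc (u / 2))\<^sup>2 / (2 * pi) + - 2 / (pi * u\<^sup>2)) (at u)"
      unfolding G_def[abs_def] using u
      by (intro DERIV_add DERIV_fejer_cdf)
         (auto intro!: derivative_eq_intros simp: power2_eq_square field_simps)
    have "(sin (u / 2))\<^sup>2 \<le> 1" by (simp add: abs_square_le_1)
    then have "(sinc (u / 2))\<^sup>2 / (2 * pi) + - 2 / (pi * u\<^sup>2) \<le> 0"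
      using u by (simp add: field_simps power_divide)
    with d show "\<exists>y. (G has_real_derivative y) (at u) \<and> y \<le> 0" by blast
  qed
  moreover have "(G \<longlongrightarrow> 1) at_top"
  proof -
    have "((\<lambda>u::real. (2 / pi) / u) \<longlongrightarrow> 0) at_top"
      by (intro tendsto_divide_0[OF tendsto_const] filterlim_at_top_imp_at_infinity filterlim_ident)
    then have "(G \<longlongrightarrow> 1 + 0) at_top"
      unfolding G_def[abs_def] by (intro tendsto_add fejer_cdf_at_top) (simp add: field_simps)
    then show ?thesis by simp
  qed
  ultimately have "1 \<le> G b"
    by (intro tendsto_upperbound[of G 1 at_top])
       (auto intro: eventually_mono[OF eventually_ge_at_top[of b]])
  then show ?thesis by (simp add: G_def)
qed

definition fejer_distribution :: "real measure" where
  "fejer_distribution = interval_measure fejer_cdf"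

lemma real_distribution_fejer: "real_distribution fejer_distribution"
  unfolding fejer_distribution_def
  by (intro real_distribution_interval_measure fejer_cdf_mono fejer_cdf_at_top fejer_cdf_at_bot
      continuous_at_right_fejer_cdf)

lemma cdf_fejer: "cdf fejer_distribution = fejer_cdf"
  unfolding fejer_distribution_def
  by (intro cdf_interval_measure fejer_cdf_mono fejer_cdf_at_bot
      continuous_at_right_fejer_cdf)

interpretation fejer: real_distribution fejer_distribution
  by (rule real_distribution_fejer)

lemma measure_fejer_atMost: "measure fejer_distribution {..u} = fejer_cdf u"
  unfolding cdf_fejer[symmetric] cdf_def ..

lemma fejer_symmetric: "distr fejer_distribution borel uminus = fejer_distribution"
proof (rule cdf_unique)
  show "real_distribution (distr fejer_distribution borel uminus)"
    by (rule fejer.real_distribution_distr) simp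
  show "real_distribution fejer_distribution" by (rule real_distribution_fejer)
  show "cdf (distr fejer_distribution borel uminus) = cdf fejer_distribution"
  proof
    fix u :: real
    have "uminus -` {..u} = {- u..}" by auto
    then have "cdf (distr fejer_distribution borel uminus) u = measure fejer_distribution {- u..}"
      unfolding cdf_def by (subst measure_distr) simp_all
    also have "\<dots> = measure fejer_distribution (UNIV - {..<- u})"
      by (rule arg_cong[where f = "measure _"]) auto
    also have "\<dots> = 1 - measure fejer_distribution {..<- u}"
      using fejer.prob_compl[of "{..<- u}"] by simp
    also have "measure fejer_distribution {..<- u} = fejer_cdf (- u)"
    proof (rule tendsto_unique[OF _ fejer.cdf_at_left])
      show "(cdf fejer_distribution \<longlongrightarrow> fejer_cdf (- u)) (at_left (- u))"
        unfolding cdf_fejer 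
        using continuous_at_imp_continuous_within[OF isCont_fejer_cdf[of "- u"]]
        by (simp add: continuous_within)
    qed simp
    finally show "cdf (distr fejer_distribution borel uminus) u = cdf fejer_distribution u"
      by (simp only: fejer_cdf_minus cdf_fejer)
  qed
qed

lemma fejer_tail:
  assumes "b > 0" shows "measure fejer_distribution (- {- b..b}) \<le> 4 / (pi * b)"
proof -
  have "measure fejer_distribution (- {- b..b})
      \<le> measure fejer_distribution {..- b} + measure fejer_distribution {b<..}"
    by (rule order_trans[OF _ measure_Un_le]) (auto intro!: fejer.finite_measure_mono)
  also have "measure fejer_distribution {b<..} = 1 - fejer_cdf b"
    using fejer.prob_compl[of "{..b}"] by (simp add: measure_fejer_atMost Compl_eq_Diff_UNIV[symmetric])
  also have "measure fejer_distribution {..- b} = 1 - fejer_cdf b"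
    by (simp add: measure_fejer_atMost fejer_cdf_minus)
  finally show ?thesis
    using fejer_cdf_tail[OF assms] by (simp add: field_simps)
qed

text \<open>The averaging step of Esseen's argument. On \<open>[- b, b]\<close> the linear term integrates to zero
by symmetry; outside, \<open>f\<close> is bounded trivially and the tail estimate applies.\<close>

lemma fejer_integral_lower:
  fixes f :: "real \<Rightarrow> real"
  assumes [measurable]: "f \<in> borel_measurable borel"
    and bnd: "\<And>y. \<bar>f y\<bar> \<le> \<eta>"
    and lin: "\<And>y. \<bar>y\<bar> \<le> b \<Longrightarrow> a + c * y \<le> f y"
    and "a \<ge> 0" "b > 0"
  shows "a - (a + \<eta>) * (4 / (pi * b)) \<le> (LINT y|fejer_distribution. f y)"
proof -
  let ?I = "{- b..b}"
  have eta: "\<eta> \<ge> 0" using bnd[of 0] by simp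
  have int1: "integrable fejer_distribution (\<lambda>y. indicat_real ?I y * y)"
    using \<open>b > 0\<close> by (intro fejer.integrable_const_bound[of _ b] AE_I2) (auto split: split_indicator)
  have int2: "integrable fejer_distribution (indicat_real ?I)"
       "integrable fejer_distribution (indicat_real (- ?I))"
    by (auto intro!: fejer.integrable_const_bound[of _ 1])
  have odd: "(LINT y|fejer_distribution. indicat_real ?I y * y) = 0"
  proof -
    have "(LINT y|fejer_distribution. indicat_real ?I y * y)
        = (LINT y|distr fejer_distribution borel uminus. indicat_real ?I y * y)"
      by (simp add: fejer_symmetric)
    also have "\<dots> = (LINT y|fejer_distribution. indicat_real ?I (- y) * (- y))"
      by (subst integral_distr) auto
    also have "\<dots> = - (LINT y|fejer_distribution. indicat_real ?I y * y)"
      by (subst integral_minus[symmetric], rule Bochner_Integration.integral_cong) (auto split: split_indicator)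
    finally show ?thesis by simp
  qed
  have m1: "measure fejer_distribution ?I = 1 - measure fejer_distribution (- ?I)"
    using fejer.prob_compl[of ?I] by (simp add: Compl_eq_Diff_UNIV[symmetric])
  have "(LINT y|fejer_distribution. a * indicat_real ?I y + c * (indicat_real ?I y * y) - \<eta> * indicat_real (- ?I) y)
     \<le> (LINT y|fejer_distribution. f y)"
  proof (rule integral_mono)
    show "integrable fejer_distribution f"
      by (rule fejer.integrable_const_bound[of _ \<eta>]) (auto simp: bnd)
    show "integrable fejer_distribution
      (\<lambda>y. a * indicat_real ?I y + c * (indicat_real ?I y * y) - \<eta> * indicat_real (- ?I) y)"
      by (intro Bochner_Integration.integrable_diff Bochner_Integration.integrable_add
          integrable_mult_right int1 int2)
    fix y
    show "a * indicat_real ?I y + c * (indicat_real ?I y * y) - \<eta> * indicat_real (- ?I) y \<le> f y"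
      using bnd[of y] lin[of y] by (auto split: split_indicator)
  qed
  also have "(LINT y|fejer_distribution. a * indicat_real ?I y + c * (indicat_real ?I y * y) - \<eta> * indicat_real (- ?I) y)
     = a * measure fejer_distribution ?I + c * 0 - \<eta> * measure fejer_distribution (- ?I)"
    using int1 int2 unfolding odd[symmetric] by simp
  also have "\<dots> = a - (a + \<eta>) * measure fejer_distribution (- ?I)"
    unfolding m1 by (simp add: algebra_simps)
  finally show ?thesis
    using mult_left_mono[OF fejer_tail[OF \<open>b > 0\<close>], of "a + \<eta>"] eta \<open>a \<ge> 0\<close> by linarith
qed

section \<open>The smoothing inequality\<close>

text \<open>Both sides are the probability that \<open>w + y / T \<le> x\<close> for independent \<open>w\<close> and \<open>y\<close>, where
\<open>w\<close> has law \<open>\<mu>\<close> and \<open>y\<close> is Fejer distributed.\<close>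

lemma fejer_smoothing_eq_cdf_average:
  assumes "real_distribution \<mu>" and "T > 0"
  shows "(LINT w|\<mu>. fejer_cdf (T * (x - w))) = (LINT y|fejer_distribution. cdf \<mu> (x - y / T))"
proof -
  interpret m: real_distribution \<mu> by fact
  interpret P: pair_prob_space \<mu> fejer_distribution ..
  let ?f = "\<lambda>w y. indicat_real {p. snd p \<le> T * (x - fst p)} (w, y)"
  have "integrable (\<mu> \<Otimes>\<^sub>M fejer_distribution) (case_prod ?f)"
    by (rule P.P.integrable_const_bound[of _ 1]) (auto split: split_indicator)
  from P.Fubini_integral[OF this]
  have "(LINT w|\<mu>. LINT y|fejer_distribution. ?f w y) = (LINT y|fejer_distribution. LINT w|\<mu>. ?f w y)"
    by simp
  also have "(\<lambda>w. LINT y|fejer_distribution. ?f w y) = (\<lambda>w. fejer_cdf (T * (x - w)))"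
  proof
    fix w
    have "(\<lambda>y. ?f w y) = indicator {..T * (x - w)}"
      by (auto split: split_indicator)
    then show "(LINT y|fejer_distribution. ?f w y) = fejer_cdf (T * (x - w))"
      by (simp add: measure_fejer_atMost)
  qed
  also have "(\<lambda>y. LINT w|\<mu>. ?f w y) = (\<lambda>y. cdf \<mu> (x - y / T))"
  proof
    fix y
    have "(\<lambda>w. ?f w y) = indicator {..x - y / T}"
      using \<open>T > 0\<close> by (auto simp: field_simps split: split_indicator)
    then show "(LINT w|\<mu>. ?f w y) = cdf \<mu> (x - y / T)"
      by (simp add: cdf_def)
  qed
  finally show ?thesis .
qed

lemma (in real_distribution) borel_measurable_cdf_affine:
  "(\<lambda>y. cdf M (x - y / T)) \<in> borel_measurable borel"
proof -
  have "mono (cdf M)" by (simp add: mono_def cdf_nondecreasing)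
  then have [measurable]: "cdf M \<in> borel_measurable borel"
    by (rule borel_measurable_mono)
  show ?thesis by measurable
qed

text \<open>If the difference \<open>\<Delta>\<close> of the distribution functions nearly attains \<open>\<plusminus> \<eta>\<close> at a point
\<open>x\<^sub>0\<close>, then monotonicity of \<open>cdf \<mu>\<close> and the Lipschitz bound keep \<open>\<bar>\<Delta>\<bar>\<close> above a linear function on an interval of
length about \<open>\<eta> / m\<close> on one side of \<open>x\<^sub>0\<close>. Averaging over a Fejer variable centred in that interval leaves at least
\<open>\<eta> / 2\<close> minus a tail term of order \<open>m / T\<close>.\<close>

theorem fejer_smoothing_inequality:
  assumes M: "real_distribution \<mu>" and N: "real_distribution \<nu>"
    and T: "T > 0" and m: "m > 0"
    and lip: "\<And>x y. x \<le> y \<Longrightarrow> cdf \<nu> y - cdf \<nu> x \<le> m * (y - x)"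
    and J: "\<And>x. \<bar>(LINT w|\<mu>. fejer_cdf (T * (x - w))) - (LINT w|\<nu>. fejer_cdf (T * (x - w)))\<bar> \<le> J"
  shows "\<bar>cdf \<mu> x - cdf \<nu> x\<bar> \<le> 2 * J + 24 * m / (pi * T)"
proof -
  interpret m: real_distribution \<mu> by fact
  interpret n: real_distribution \<nu> by fact
  define \<Delta> where "\<Delta> x = cdf \<mu> x - cdf \<nu> x" for x
  define \<eta> where "\<eta> = (SUP x. \<bar>\<Delta> x\<bar>)"
  note [measurable] = m.borel_measurable_cdf_affine n.borel_measurable_cdf_affine
  have D1: "\<bar>\<Delta> x\<bar> \<le> 1" for x
    unfolding \<Delta>_def using m.cdf_nonneg[of x] m.cdf_bounded_prob[of x] n.cdf_nonneg[of x] n.cdf_bounded_prob[of x]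
    by linarith
  have bdd: "bdd_above (range (\<lambda>x. \<bar>\<Delta> x\<bar>))"
    using D1 by (auto intro!: bdd_aboveI[of _ 1])
  have le_eta: "\<bar>\<Delta> x\<bar> \<le> \<eta>" for x
    unfolding \<eta>_def by (rule cSUP_upper[OF _ bdd]) simp
  have avg: "\<bar>LINT y|fejer_distribution. \<Delta> (x - y / T)\<bar> \<le> J" for x
  proof -
    have "integrable fejer_distribution (\<lambda>y. cdf \<mu> (x - y / T))"
         "integrable fejer_distribution (\<lambda>y. cdf \<nu> (x - y / T))"
      by (auto intro!: fejer.integrable_const_bound[of _ 1] AE_I2
          simp: m.cdf_nonneg m.cdf_bounded_prob n.cdf_nonneg n.cdf_bounded_prob)
    then show ?thesis
      using J[of x] unfolding \<Delta>_def
        fejer_smoothing_eq_cdf_average[OF M T] fejer_smoothing_eq_cdf_average[OF N T]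
      by simp
  qed
  have meas: "(\<lambda>y. \<Delta> (x - y / T)) \<in> borel_measurable borel" for x
    unfolding \<Delta>_def by measurable
  have key: "e / 2 - (e / 2 + \<eta>) * (8 * m / (pi * T * e)) \<le> J" if e: "0 < e" "e < \<eta>" for e
  proof -
    obtain x0 where x0: "e < \<bar>\<Delta> x0\<bar>"
      using e(2) unfolding \<eta>_def by (subst (asm) less_cSUP_iff[OF _ bdd]) auto
    \<comment> \<open>at distance \<open>h\<close> from the near-extremum, the linear bound has dropped to \<open>e / 2\<close>\<close>
    define h where "h = e / (2 * m)"
    have mh: "m * h = e / 2" and h0: "h > 0"
      using m e by (auto simp: h_def field_simps)
    have b: "4 / (pi * (T * h)) = 8 * m / (pi * T * e)" "T * h > 0"
      using T m e by (auto simp: h_def field_simps)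
    consider (pos) "\<Delta> x0 > e" | (neg) "\<Delta> x0 < - e" using x0 by linarith
    then show ?thesis
    proof cases
      case pos
      have "e / 2 + (m / T) * y \<le> \<Delta> (x0 + h - y / T)" if y: "\<bar>y\<bar> \<le> T * h" for y
      proof -
        have le: "x0 \<le> x0 + h - y / T"
          using y T by (auto simp: field_simps)
        have "cdf \<mu> x0 \<le> cdf \<mu> (x0 + h - y / T)"
          by (rule m.cdf_nondecreasing[OF le])
        with lip[OF le] have "\<Delta> x0 - m * (h - y / T) \<le> \<Delta> (x0 + h - y / T)"
          unfolding \<Delta>_def by (simp add: algebra_simps)
        with pos mh show ?thesis by (simp add: algebra_simps)
      qed
      from fejer_integral_lower[OF meas le_eta this _ b(2)] avg[of "x0 + h"] e
      show ?thesis unfolding b by linarith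
    next
      case neg
      have "e / 2 + (- (m / T)) * y \<le> - \<Delta> (x0 - h - y / T)" if y: "\<bar>y\<bar> \<le> T * h" for y
      proof -
        have le: "x0 - h - y / T \<le> x0"
          using y T by (auto simp: field_simps)
        have "cdf \<mu> (x0 - h - y / T) \<le> cdf \<mu> x0"
          by (rule m.cdf_nondecreasing[OF le])
        with lip[OF le] have "- \<Delta> x0 - m * (h + y / T) \<le> - \<Delta> (x0 - h - y / T)"
          unfolding \<Delta>_def by (simp add: algebra_simps)
        with neg mh show ?thesis by (simp add: algebra_simps)
      qed
      from fejer_integral_lower[where f = "\<lambda>y. - \<Delta> (x0 - h - y / T)", OF _ _ this _ b(2), of \<eta>]
        avg[of "x0 - h"] e meas[of "x0 - h"] le_eta
      show ?thesis unfolding b by simp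
    qed
  qed
  \<comment> \<open>the supremum need not be attained, hence the limit \<open>e \<longlonglongrightarrow> \<eta>\<close>\<close>
  have "\<eta> \<le> 2 * J + 24 * m / (pi * T)"
  proof (cases "\<eta> > 0")
    case True
    have "((\<lambda>e. e / 2 - (e / 2 + \<eta>) * (8 * m / (pi * T * e))) \<longlongrightarrow>
        \<eta> / 2 - (\<eta> / 2 + \<eta>) * (8 * m / (pi * T * \<eta>))) (at_left \<eta>)"
      using T True by (intro tendsto_intros) auto
    then have "\<eta> / 2 - (\<eta> / 2 + \<eta>) * (8 * m / (pi * T * \<eta>)) \<le> J"
      by (rule tendsto_upperbound)
         (use True key in \<open>auto simp: eventually_at_left_field intro!: exI[of _ 0]\<close>)
    moreover have "(\<eta> / 2 + \<eta>) * (8 * m / (pi * T * \<eta>)) = 12 * m / (pi * T)"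
      using True T by (simp add: field_simps)
    ultimately show ?thesis by simp
  next
    case False
    have "J \<ge> 0" using J[of 0] by linarith
    then have "0 \<le> 2 * J + 24 * m / (pi * T)" using m T by simp
    with False show ?thesis by linarith
  qed
  with le_eta[of x] show ?thesis by (simp add: \<Delta>_def)
qed

section \<open>Smoothed differences in terms of characteristic functions\<close>

text \<open>The Fourier representation of \<open>fejer_cdf (T * u)\<close> is
\<open>1 / 2 + (1 / \<pi>) \<integral>\<^sub>0\<^sup>T (1 - t / T) sin (t u) / t dt\<close>. This is the integral from \<open>\<delta>\<close> to \<open>T\<close>. Without the cut the
absolute integral grows like \<open>ln \<bar>u\<bar>\<close>, and Fubini's theorem would then need more moments than a square integrable
variable weighted by its square has; with the cut it applies, and the limit \<open>\<delta> \<longlonglongrightarrow> 0\<close> is dominated because \<open>Si\<close> is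
bounded.\<close>

definition fejer_kernel_cut :: "real \<Rightarrow> real \<Rightarrow> real \<Rightarrow> real" where
  "fejer_kernel_cut \<delta> T u = Si (T * u) - Si (\<delta> * u) - (cos (\<delta> * u) - cos (T * u)) / (T * u)"

lemma borel_measurable_fejer_kernel_cut [measurable]: "fejer_kernel_cut \<delta> T \<in> borel_measurable borel"
  unfolding fejer_kernel_cut_def[abs_def] by measurable

lemma fejer_kernel_cut_eq:
  assumes "0 < \<delta>" "\<delta> \<le> T"
  shows "(LINT t|lborel. indicat_real {\<delta>..T} t * ((1 - t / T) / t * sin (t * u))) = fejer_kernel_cut \<delta> T u"
proof (cases "u = 0")
  case True
  have "Si 0 = 0" using Si_neg[of 0] by simp
  with True show ?thesis by (simp add: fejer_kernel_cut_def)
next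
  case False
  have "(LINT t|lborel. indicat_real {\<delta>..T} t *\<^sub>R ((1 - t / T) / t * sin (t * u)))
     = (Si (T * u) + cos (T * u) / (T * u)) - (Si (\<delta> * u) + cos (\<delta> * u) / (T * u))"
  proof (rule integral_FTC_atLeastAtMost)
    show "continuous_on {\<delta>..T} (\<lambda>t. (1 - t / T) / t * sin (t * u))"
      using assms by (intro continuous_intros) auto
    fix t assume t: "\<delta> \<le> t" "t \<le> T"
    then have "t > 0" using assms by simp
    have "((\<lambda>t. Si (t * u) + cos (t * u) / (T * u)) has_real_derivative
        sinc (t * u) * u + (- sin (t * u) * u) / (T * u)) (at t)"
      by (intro DERIV_add DERIV_cdivide DERIV_chain2[OF DERIV_Si])
        (auto intro!: derivative_eq_intros)
    also have "sinc (t * u) * u + (- sin (t * u) * u) / (T * u) = (1 - t / T) / t * sin (t * u)"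
      using False \<open>t > 0\<close> assms by (simp add: field_simps)
    finally show "((\<lambda>t. Si (t * u) + cos (t * u) / (T * u)) has_vector_derivative
        (1 - t / T) / t * sin (t * u)) (at t within {\<delta>..T})"
      by (simp add: has_real_derivative_iff_has_vector_derivative has_vector_derivative_at_within)
  qed (use assms in simp)
  then show ?thesis
    by (simp add: fejer_kernel_cut_def field_simps diff_divide_distrib)
qed

lemma fejer_kernel_cut_bounded:
  "\<exists>B. \<forall>\<delta> T u. 0 < \<delta> \<longrightarrow> \<delta> \<le> T \<longrightarrow> \<bar>fejer_kernel_cut \<delta> T u\<bar> \<le> B"
proof -
  obtain B where B: "\<And>u. \<bar>Si u\<bar> \<le> B" using bounded_Si by blast
  have "\<bar>fejer_kernel_cut \<delta> T u\<bar> \<le> 2 * B + 1" if "0 < \<delta>" "\<delta> \<le> T" for \<delta> T u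
  proof -
    have "\<bar>cos (\<delta> * u) - cos (T * u)\<bar> \<le> 2 * (1 * \<bar>(T * u - \<delta> * u) / 2\<bar>)"
      unfolding cos_diff_cos abs_mult
      by (simp only: mult.assoc abs_numeral) (intro mult_left_mono mult_mono abs_sin_x_le_abs_x; simp)
    also have "\<dots> = \<bar>T * u - \<delta> * u\<bar>" by simp
    also have "\<dots> = (T - \<delta>) * \<bar>u\<bar>"
      using that by (simp add: left_diff_distrib[symmetric] abs_mult)
    also have "\<dots> \<le> \<bar>T * u\<bar>"
      using that by (simp add: abs_mult mult_right_mono)
    finally have "\<bar>(cos (\<delta> * u) - cos (T * u)) / (T * u)\<bar> \<le> 1"
      by (cases "T * u = 0") (simp_all add: divide_le_eq)
    then show ?thesis
      unfolding fejer_kernel_cut_def using B[of "T * u"] B[of "\<delta> * u"] by linarith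
  qed
  then show ?thesis by blast
qed

lemma fejer_kernel_cut_tendsto:
  "((\<lambda>\<delta>. fejer_kernel_cut \<delta> T u) \<longlongrightarrow> pi * (fejer_cdf (T * u) - 1 / 2)) (at_right 0)"
proof -
  have "Si 0 = 0" using Si_neg[of 0] by simp
  have "((\<lambda>\<delta>. fejer_kernel_cut \<delta> T u) \<longlongrightarrow>
      Si (T * u) - Si (0 * u) - (cos (0 * u) - cos (T * u)) / (T * u)) (at_right 0)"
    unfolding fejer_kernel_cut_def divide_inverse[of "_ - _"]
    by (intro tendsto_intros isCont_tendsto_compose[OF isCont_Si])
  moreover have "pi * (fejer_cdf (T * u) - 1 / 2) = Si (T * u) - (1 - cos (T * u)) / (T * u)"
    by (simp add: fejer_cdf_def)
  ultimately show ?thesis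
    by (simp add: \<open>Si 0 = 0\<close>)
qed

context prob_space begin

lemma expectation_fejer_kernel_cut:
  fixes Q X :: "'a \<Rightarrow> real" and x :: real
  assumes Q: "integrable M Q" and X[measurable]: "X \<in> borel_measurable M"
    and \<delta>: "0 < \<delta>" "\<delta> \<le> T"
  defines "S \<equiv> \<lambda>t. expectation (\<lambda>\<omega>. Q \<omega> * sin (t * (x - X \<omega>)))"
  shows "integrable lborel (\<lambda>t. indicat_real {\<delta>..T} t * ((1 - t / T) / t * S t))"
    and "expectation (\<lambda>\<omega>. Q \<omega> * fejer_kernel_cut \<delta> T (x - X \<omega>))
       = (LINT t|lborel. indicat_real {\<delta>..T} t * ((1 - t / T) / t * S t))"
proof -
  interpret P: pair_sigma_finite M lborel ..
  have [measurable]: "Q \<in> borel_measurable M" using Q by simp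
  define f where "f \<omega> t = Q \<omega> * (indicat_real {\<delta>..T} t * ((1 - t / T) / t * sin (t * (x - X \<omega>))))" for \<omega> t
  have fm: "case_prod f \<in> borel_measurable (M \<Otimes>\<^sub>M lborel)"
    unfolding f_def[abs_def] by measurable
  have gint: "integrable lborel (\<lambda>t. indicat_real {\<delta>..T} t * ((1 - t / T) / t * sin (t * u)))" for u
  proof -
    have "set_integrable lborel {\<delta>..T} (\<lambda>t. (1 - t / T) / t * sin (t * u))"
      using \<delta> by (intro borel_integrable_atLeastAtMost' continuous_intros) auto
    then show ?thesis by (simp add: set_integrable_def)
  qed
  have bint: "integrable lborel (\<lambda>t. indicat_real {\<delta>..T} t * (1 / \<delta>))"
    by (intro integrable_mult_left integrable_real_indicator) (auto simp: emeasure_lborel_Icc_eq)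
  have bd: "\<bar>indicat_real {\<delta>..T} t * ((1 - t / T) / t * sin (t * u))\<bar> \<le> indicat_real {\<delta>..T} t * (1 / \<delta>)" for t u
  proof (cases "t \<in> {\<delta>..T}")
    case True
    then have "\<bar>(1 - t / T) / t\<bar> \<le> 1 / \<delta>"
      using \<delta> by (auto simp: abs_divide intro!: frac_le)
    then have "\<bar>(1 - t / T) / t * sin (t * u)\<bar> \<le> 1 / \<delta> * 1"
      unfolding abs_mult using \<delta> by (intro mult_mono) auto
    with True show ?thesis by simp
  qed simp
  have fi: "integrable (M \<Otimes>\<^sub>M lborel) (case_prod f)"
  proof (rule P.Fubini_integrable[OF fm])
    show "AE \<omega> in M. integrable lborel (\<lambda>t. case_prod f (\<omega>, t))"
      unfolding f_def prod.case by (intro AE_I2 integrable_mult_right gint)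
    have "integrable M (\<lambda>\<omega>. (T - \<delta>) / \<delta> * norm (Q \<omega>))" using Q by simp
    then show "integrable M (\<lambda>\<omega>. LINT t|lborel. norm (case_prod f (\<omega>, t)))"
    proof (rule Bochner_Integration.integrable_bound)
      show "(\<lambda>\<omega>. LINT t|lborel. norm (case_prod f (\<omega>, t))) \<in> borel_measurable M"
        using fm by measurable
      show "AE \<omega> in M. norm (LINT t|lborel. norm (case_prod f (\<omega>, t))) \<le> norm ((T - \<delta>) / \<delta> * norm (Q \<omega>))"
      proof (rule AE_I2)
        fix \<omega>
        have "(LINT t|lborel. norm (case_prod f (\<omega>, t))) \<le> (LINT t|lborel. \<bar>Q \<omega>\<bar> * (indicat_real {\<delta>..T} t * (1 / \<delta>)))"
        proof (rule integral_mono)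
          show "integrable lborel (\<lambda>t. norm (case_prod f (\<omega>, t)))"
            unfolding f_def prod.case by (intro integrable_norm integrable_mult_right gint)
          show "integrable lborel (\<lambda>t. \<bar>Q \<omega>\<bar> * (indicat_real {\<delta>..T} t * (1 / \<delta>)))"
            by (intro integrable_mult_right bint)
          show "norm (case_prod f (\<omega>, t)) \<le> \<bar>Q \<omega>\<bar> * (indicat_real {\<delta>..T} t * (1 / \<delta>))" for t
            unfolding f_def prod.case real_norm_def abs_mult[of "Q \<omega>"] by (intro mult_left_mono bd) simp
        qed
        also have "\<dots> = (T - \<delta>) / \<delta> * norm (Q \<omega>)"
          using \<delta> by simp
        finally show "norm (LINT t|lborel. norm (case_prod f (\<omega>, t))) \<le> norm ((T - \<delta>) / \<delta> * norm (Q \<omega>))"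
          using \<delta> by (simp add: abs_mult)
      qed
    qed
  qed
  have e1: "(LINT \<omega>|M. f \<omega> t) = indicat_real {\<delta>..T} t * ((1 - t / T) / t * S t)" for t
  proof -
    have "f \<omega> t = (indicat_real {\<delta>..T} t * ((1 - t / T) / t)) * (Q \<omega> * sin (t * (x - X \<omega>)))" for \<omega>
      by (simp add: f_def)
    then show ?thesis by (simp add: S_def)
  qed
  have e2: "(LINT t|lborel. f \<omega> t) = Q \<omega> * fejer_kernel_cut \<delta> T (x - X \<omega>)" for \<omega>
    unfolding f_def by (subst integral_mult_right_zero) (simp only: fejer_kernel_cut_eq[OF \<delta>])
  show "integrable lborel (\<lambda>t. indicat_real {\<delta>..T} t * ((1 - t / T) / t * S t))"
    using P.integrable_snd[OF fi] by (simp add: e1)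
  show "expectation (\<lambda>\<omega>. Q \<omega> * fejer_kernel_cut \<delta> T (x - X \<omega>))
       = (LINT t|lborel. indicat_real {\<delta>..T} t * ((1 - t / T) / t * S t))"
    using P.Fubini_integral[OF fi] by (simp add: e1 e2)
qed

lemma integrable_weighted_iexp:
  fixes Q X :: "'a \<Rightarrow> real"
  assumes Q: "integrable M Q" and X[measurable]: "X \<in> borel_measurable M"
  shows "integrable M (\<lambda>\<omega>. Q \<omega> * iexp (t * X \<omega>))"
  using Q by (rule Bochner_Integration.integrable_bound)
    (use Q in \<open>auto simp: norm_mult simp del: of_real_mult\<close>)

lemma expectation_weighted_sin:
  fixes Q X :: "'a \<Rightarrow> real"
  assumes Q: "integrable M Q" and X[measurable]: "X \<in> borel_measurable M"
  shows "expectation (\<lambda>\<omega>. Q \<omega> * sin (t * (x - X \<omega>)))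
      = Im (iexp (t * x) * cnj (CLINT \<omega>|M. Q \<omega> * iexp (t * X \<omega>)))"
proof -
  have I: "integrable M (\<lambda>\<omega>. Q \<omega> * iexp (t * X \<omega>))"
    by (rule integrable_weighted_iexp[OF assms])
  have "Q \<omega> * sin (t * (x - X \<omega>)) = Im (iexp (t * x) * cnj (Q \<omega> * iexp (t * X \<omega>)))" for \<omega>
    by (simp add: Im_exp Re_exp right_diff_distrib[of t] sin_diff) (simp only: algebra_simps)
  then have "expectation (\<lambda>\<omega>. Q \<omega> * sin (t * (x - X \<omega>)))
     = (LINT \<omega>|M. Im (iexp (t * x) * cnj (Q \<omega> * iexp (t * X \<omega>))))" by (simp only:)
  also have "\<dots> = Im (CLINT \<omega>|M. iexp (t * x) * cnj (Q \<omega> * iexp (t * X \<omega>)))"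
    by (rule integral_Im) (intro integrable_mult_right integrable_cnj I)
  also have "(CLINT \<omega>|M. iexp (t * x) * cnj (Q \<omega> * iexp (t * X \<omega>)))
     = iexp (t * x) * (CLINT \<omega>|M. cnj (Q \<omega> * iexp (t * X \<omega>)))"
    by (rule integral_mult_right_zero)
  also have "(CLINT \<omega>|M. cnj (Q \<omega> * iexp (t * X \<omega>))) = cnj (CLINT \<omega>|M. Q \<omega> * iexp (t * X \<omega>))"
    using Bochner_Integration.integral_cnj[of M "\<lambda>\<omega>. Q \<omega> * iexp (t * X \<omega>)"] .
  finally show ?thesis .
qed

lemma expectation_fejer_kernel_cut_tendsto:
  fixes Q X :: "'a \<Rightarrow> real"
  assumes Q: "integrable M Q" and X[measurable]: "X \<in> borel_measurable M" and T: "T > 0"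
  shows "(\<lambda>i. expectation (\<lambda>\<omega>. Q \<omega> * fejer_kernel_cut (T / real (Suc i)) T (x - X \<omega>)))
    \<longlonglongrightarrow> pi * (expectation (\<lambda>\<omega>. Q \<omega> * fejer_cdf (T * (x - X \<omega>))) - expectation Q / 2)"
proof -
  have [measurable]: "Q \<in> borel_measurable M" using Q by simp
  obtain B where B: "\<And>\<delta> T u. 0 < \<delta> \<Longrightarrow> \<delta> \<le> T \<Longrightarrow> \<bar>fejer_kernel_cut \<delta> T u\<bar> \<le> B"
    using fejer_kernel_cut_bounded by blast
  have d: "0 < T / real (Suc i)" "T / real (Suc i) \<le> T" for i
    using T by (auto simp: field_simps)
  have lim: "filterlim (\<lambda>i. T / real (Suc i)) (at_right 0) sequentially"
    unfolding filterlim_at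
  proof (intro conjI always_eventually allI)
    show "(\<lambda>i. T / real (Suc i)) \<longlonglongrightarrow> 0"
      by (rule LIMSEQ_Suc[OF lim_const_over_n])
    show "T / real (Suc i) \<in> {0<..}" "T / real (Suc i) \<noteq> 0" for i
      using d[of i] by auto
  qed
  have K: "integrable M (\<lambda>\<omega>. Q \<omega> * fejer_cdf (T * (x - X \<omega>)))"
    using Q by (rule Bochner_Integration.integrable_bound)
      (auto simp: abs_mult fejer_cdf_bounds intro!: mult_left_le)
  have "(\<lambda>i. expectation (\<lambda>\<omega>. Q \<omega> * fejer_kernel_cut (T / real (Suc i)) T (x - X \<omega>)))
    \<longlonglongrightarrow> expectation (\<lambda>\<omega>. Q \<omega> * (pi * (fejer_cdf (T * (x - X \<omega>)) - 1 / 2)))"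
  proof (rule integral_dominated_convergence[where w = "\<lambda>\<omega>. \<bar>Q \<omega>\<bar> * B"])
    show "AE \<omega> in M. (\<lambda>i. Q \<omega> * fejer_kernel_cut (T / real (Suc i)) T (x - X \<omega>))
      \<longlonglongrightarrow> Q \<omega> * (pi * (fejer_cdf (T * (x - X \<omega>)) - 1 / 2))"
      by (intro AE_I2 tendsto_mult tendsto_const filterlim_compose[OF fejer_kernel_cut_tendsto lim])
    show "AE \<omega> in M. norm (Q \<omega> * fejer_kernel_cut (T / real (Suc i)) T (x - X \<omega>)) \<le> \<bar>Q \<omega>\<bar> * B" for i
      using B[OF d[of i]] by (auto simp: abs_mult intro!: AE_I2 mult_left_mono)
  qed (use Q in auto)
  also have "expectation (\<lambda>\<omega>. Q \<omega> * (pi * (fejer_cdf (T * (x - X \<omega>)) - 1 / 2)))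
     = expectation (\<lambda>\<omega>. pi * (Q \<omega> * fejer_cdf (T * (x - X \<omega>))) - pi / 2 * Q \<omega>)"
    by (rule Bochner_Integration.integral_cong) (auto simp: algebra_simps)
  also have "\<dots> = pi * expectation (\<lambda>\<omega>. Q \<omega> * fejer_cdf (T * (x - X \<omega>))) - pi / 2 * expectation Q"
    using Q K by simp
  finally show ?thesis by (simp add: algebra_simps)
qed

end

text \<open>Equal total weights make the constant \<open>1 / 2\<close> in the Fourier representation cancel. The
weights are arbitrary integrable random variables, not functions of \<open>X\<close> and \<open>Y\<close>, so that the theorem applies to a
part of \<open>W\<^sup>2\<close> as well as to the constant weight.\<close>

theorem fejer_weighted_difference:
  fixes X Q :: "'a \<Rightarrow> real" and Y R :: "'b \<Rightarrow> real"
  assumes M: "prob_space M" and N: "prob_space N"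
    and Q: "integrable M Q" and X: "X \<in> borel_measurable M"
    and R: "integrable N R" and Y: "Y \<in> borel_measurable N"
    and mass: "(LINT \<omega>|M. Q \<omega>) = (LINT \<omega>|N. R \<omega>)"
    and T: "T > 0"
    and bound: "\<And>t. 0 < t \<Longrightarrow> t \<le> T \<Longrightarrow>
      cmod ((CLINT \<omega>|M. Q \<omega> * iexp (t * X \<omega>)) - (CLINT \<omega>|N. R \<omega> * iexp (t * Y \<omega>))) \<le> t * g t"
    and G: "\<And>t. 0 \<le> t \<Longrightarrow> t \<le> T \<Longrightarrow> (G has_real_derivative g t) (at t)"
    and g: "continuous_on {0..T} g"
  shows "\<bar>(LINT \<omega>|M. Q \<omega> * fejer_cdf (T * (x - X \<omega>))) - (LINT \<omega>|N. R \<omega> * fejer_cdf (T * (x - Y \<omega>)))\<bar>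
    \<le> (G T - G 0) / pi"
proof -
  interpret M: prob_space M by fact
  interpret N: prob_space N by fact
  let ?d = "\<lambda>i. T / real (Suc i)"
  have d: "0 < ?d i" "?d i \<le> T" for i
    using T by (auto simp: field_simps)
  have cut: "\<bar>(LINT \<omega>|M. Q \<omega> * fejer_kernel_cut (?d i) T (x - X \<omega>))
      - (LINT \<omega>|N. R \<omega> * fejer_kernel_cut (?d i) T (x - Y \<omega>))\<bar> \<le> G T - G 0" for i
  proof -
    let ?S = "\<lambda>t. M.expectation (\<lambda>\<omega>. Q \<omega> * sin (t * (x - X \<omega>)))"
    let ?S' = "\<lambda>t. N.expectation (\<lambda>\<omega>. R \<omega> * sin (t * (x - Y \<omega>)))"
    note eM = M.expectation_fejer_kernel_cut[OF Q X d, of i x]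
    note eN = N.expectation_fejer_kernel_cut[OF R Y d, of i x]
    have gi: "integrable lborel (\<lambda>t. indicat_real {0..T} t * g t)"
      using borel_integrable_atLeastAtMost'[OF g] by (simp add: set_integrable_def)
    have SS: "\<bar>?S t - ?S' t\<bar> \<le> t * g t" if "0 < t" "t \<le> T" for t
    proof -
      have "?S t - ?S' t = Im (iexp (t * x) * cnj ((CLINT \<omega>|M. Q \<omega> * iexp (t * X \<omega>)) - (CLINT \<omega>|N. R \<omega> * iexp (t * Y \<omega>))))"
        unfolding M.expectation_weighted_sin[OF Q X] N.expectation_weighted_sin[OF R Y]
        by (simp only: complex_cnj_diff right_diff_distrib minus_complex.sel)
      also have "\<bar>\<dots>\<bar> \<le> cmod (iexp (t * x) * cnj ((CLINT \<omega>|M. Q \<omega> * iexp (t * X \<omega>)) - (CLINT \<omega>|N. R \<omega> * iexp (t * Y \<omega>))))"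
        by (rule abs_Im_le_cmod)
      also have "\<dots> = cmod ((CLINT \<omega>|M. Q \<omega> * iexp (t * X \<omega>)) - (CLINT \<omega>|N. R \<omega> * iexp (t * Y \<omega>)))"
        by (simp only: norm_mult complex_mod_cnj norm_exp_i_times mult_1)
      finally show ?thesis using bound[OF that] by linarith
    qed
    have g0: "g t \<ge> 0" if "0 < t" "t \<le> T" for t
    proof -
      have "0 \<le> t * g t" using SS[OF that] by (rule order_trans[OF abs_ge_zero])
      with that show ?thesis by (simp add: zero_le_mult_iff)
    qed
    let ?D = "\<lambda>t. indicat_real {?d i..T} t * ((1 - t / T) / t * ?S t) - indicat_real {?d i..T} t * ((1 - t / T) / t * ?S' t)"
    have eq: "(LINT \<omega>|M. Q \<omega> * fejer_kernel_cut (?d i) T (x - X \<omega>))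
      - (LINT \<omega>|N. R \<omega> * fejer_kernel_cut (?d i) T (x - Y \<omega>)) = (LINT t|lborel. ?D t)"
      unfolding eM(2) eN(2) by (rule Bochner_Integration.integral_diff[OF eM(1) eN(1), symmetric])
    have "\<bar>LINT t|lborel. ?D t\<bar> \<le> (LINT t|lborel. \<bar>?D t\<bar>)"
      by (rule integral_abs_bound)
    also have "\<dots> \<le> (LINT t|lborel. indicat_real {0..T} t * g t)"
    proof (rule integral_mono_AE)
      show "AE t in lborel. \<bar>indicat_real {?d i..T} t * ((1 - t / T) / t * ?S t) - indicat_real {?d i..T} t * ((1 - t / T) / t * ?S' t)\<bar>
          \<le> indicat_real {0..T} t * g t"
        using AE_lborel_singleton[of 0]
      proof eventually_elim
        case (elim t)
        show ?case
        proof (cases "t \<in> {?d i..T}")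
          case True
          then have t: "0 < t" "t \<le> T" using d[of i] by auto
          have "\<bar>indicat_real {?d i..T} t * ((1 - t / T) / t * ?S t) - indicat_real {?d i..T} t * ((1 - t / T) / t * ?S' t)\<bar>
             = \<bar>(1 - t / T) * ((?S t - ?S' t) / t)\<bar>"
          proof -
            have "c / t * a - c / t * b = c * ((a - b) / t)" for a b c :: real
              by (simp add: diff_divide_distrib right_diff_distrib)
            then show ?thesis
              by (simp only: indicator_simps(1)[OF True] mult_1)
          qed
          also have "\<dots> = (1 - t / T) * (\<bar>?S t - ?S' t\<bar> / t)"
            using t T by (simp only: abs_mult abs_divide) simp
          also have "\<dots> \<le> 1 * g t"
            using t T SS[OF t] by (intro mult_mono) (auto simp: field_simps)
          finally show ?thesis using t by simp
        next
          case False
          have "0 \<le> indicat_real {0..T} t * g t"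
            using g0[of t] elim by (auto split: split_indicator)
          with False show ?thesis by simp
        qed
      qed
    qed (intro integrable_abs Bochner_Integration.integrable_diff eM(1) eN(1) gi)+
    also have "\<dots> = G T - G 0"
    proof -
      have "(G has_vector_derivative g t) (at t within {0..T})" if "0 \<le> t" "t \<le> T" for t
        using G[OF that] by (simp add: has_real_derivative_iff_has_vector_derivative has_vector_derivative_at_within)
      from integral_FTC_atLeastAtMost[OF less_imp_le[OF T] this g] show ?thesis by simp
    qed
    finally show ?thesis unfolding eq .
  qed
  have "(\<lambda>i. \<bar>(LINT \<omega>|M. Q \<omega> * fejer_kernel_cut (?d i) T (x - X \<omega>))
      - (LINT \<omega>|N. R \<omega> * fejer_kernel_cut (?d i) T (x - Y \<omega>))\<bar>) \<longlonglongrightarrow>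
    \<bar>pi * ((LINT \<omega>|M. Q \<omega> * fejer_cdf (T * (x - X \<omega>))) - (LINT \<omega>|M. Q \<omega>) / 2)
     - pi * ((LINT \<omega>|N. R \<omega> * fejer_cdf (T * (x - Y \<omega>))) - (LINT \<omega>|N. R \<omega>) / 2)\<bar>"
    by (intro tendsto_intros M.expectation_fejer_kernel_cut_tendsto N.expectation_fejer_kernel_cut_tendsto Q X R Y T)
  then have "\<bar>pi * ((LINT \<omega>|M. Q \<omega> * fejer_cdf (T * (x - X \<omega>))) - (LINT \<omega>|M. Q \<omega>) / 2)
     - pi * ((LINT \<omega>|N. R \<omega> * fejer_cdf (T * (x - Y \<omega>))) - (LINT \<omega>|N. R \<omega>) / 2)\<bar> \<le> G T - G 0"
    by (rule LIMSEQ_le_const2) (use cut in blast)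
  also have "pi * ((LINT \<omega>|M. Q \<omega> * fejer_cdf (T * (x - X \<omega>))) - (LINT \<omega>|M. Q \<omega>) / 2)
     - pi * ((LINT \<omega>|N. R \<omega> * fejer_cdf (T * (x - Y \<omega>))) - (LINT \<omega>|N. R \<omega>) / 2)
     = pi * ((LINT \<omega>|M. Q \<omega> * fejer_cdf (T * (x - X \<omega>))) - (LINT \<omega>|N. R \<omega> * fejer_cdf (T * (x - Y \<omega>))))"
    by (simp add: mass algebra_simps)
  finally show ?thesis
    unfolding abs_mult by (subst pos_le_divide_eq) (simp_all add: mult.commute)
qed

section \<open>Expansion of the characteristic function of one summand\<close>

lemma cmod_iexp_minus_1: "cmod (iexp y - 1) \<le> \<bar>y\<bar>"
  using iexp_approx1[of y 0] by simp

lemma cmod_iexp_order1: "cmod (iexp y - (1 + \<i> * y)) \<le> y\<^sup>2 / 2" "cmod (iexp y - (1 + \<i> * y)) \<le> 2 * \<bar>y\<bar>"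
  using iexp_approx1[of y 1] iexp_approx2[of y 1] by (simp_all add: power2_eq_square)

lemma cmod_iexp_order2:
  "cmod (iexp y - (1 + \<i> * y - y\<^sup>2 / 2)) \<le> \<bar>y\<bar> ^ 3 / 6" "cmod (iexp y - (1 + \<i> * y - y\<^sup>2 / 2)) \<le> y\<^sup>2"
  using iexp_approx1[of y 2] iexp_approx2[of y 2]
  by (simp_all add: power2_eq_square numeral_2_eq_2 power3_eq_cube field_simps)

lemma exp_minus_second_order:
  fixes x :: real assumes "x \<ge> 0" shows "\<bar>exp (- x) - (1 - x)\<bar> \<le> x\<^sup>2 / 2"
proof -
  define f where "f x = 1 - x + x\<^sup>2 / 2 - exp (- x)" for x :: real
  have "f 0 \<le> f x"
  proof (rule DERIV_nonneg_imp_nondecreasing[OF assms])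
    fix y :: real assume "0 \<le> y"
    have "(f has_real_derivative (- 1 + y + exp (- y))) (at y)"
      unfolding f_def by (auto intro!: derivative_eq_intros)
    moreover have "- 1 + y + exp (- y) \<ge> 0"
      using exp_ge_add_one_self[of "- y"] by simp
    ultimately show "\<exists>d. (f has_real_derivative d) (at y) \<and> d \<ge> 0" by blast
  qed
  then show ?thesis
    using exp_ge_add_one_self[of "- x"] by (simp add: f_def)
qed

lemma norm_power_diff_le:
  fixes z w :: complex
  assumes "cmod z \<le> q" "cmod w \<le> q"
  shows "cmod (z ^ n - w ^ n) \<le> real n * q ^ (n - 1) * cmod (z - w)"
proof (induction n)
  case 0
  then show ?case by simp
next
  case (Suc n)
  have q: "q \<ge> 0" using norm_ge_zero[of z] assms by linarith
  have "z ^ Suc n - w ^ Suc n = z ^ n * (z - w) + w * (z ^ n - w ^ n)"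
    by (simp add: algebra_simps)
  then have "cmod (z ^ Suc n - w ^ Suc n) \<le> cmod (z ^ n * (z - w)) + cmod (w * (z ^ n - w ^ n))"
    by (metis norm_triangle_ineq)
  also have "\<dots> \<le> q ^ n * cmod (z - w) + q * (real n * q ^ (n - 1) * cmod (z - w))"
    unfolding norm_mult norm_power using assms Suc q
    by (intro add_mono mult_mono power_mono) auto
  also have "\<dots> = real (Suc n) * q ^ (Suc n - 1) * cmod (z - w)"
    by (cases n) (auto simp: algebra_simps)
  finally show ?case .
qed

text \<open>The law of one summand.\<close>

locale centered_distribution = real_distribution M for M :: "real measure" +
  assumes integrable_id: "integrable M (\<lambda>x. x)"
    and integrable_square: "integrable M (\<lambda>x. x\<^sup>2)"
    and mean_zero: "(LINT x|M. x) = 0"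
begin

definition second_moment :: real where "second_moment = (LINT x|M. x\<^sup>2)"

definition tail2 :: real where
  "tail2 = (LINT x|M. x\<^sup>2 * indicat_real {x. \<bar>x\<bar> > 1} x)"

definition core3 :: real where
  "core3 = (LINT x|M. \<bar>x\<bar> ^ 3 * indicat_real {x. \<bar>x\<bar> \<le> 1} x)"

lemma integrable_tail2: "integrable M (\<lambda>x. x\<^sup>2 * indicat_real {x. \<bar>x\<bar> > 1} x)"
  using integrable_square by (rule Bochner_Integration.integrable_bound) (auto split: split_indicator)

lemma integrable_core2: "integrable M (\<lambda>x. x\<^sup>2 * indicat_real {x. \<bar>x\<bar> \<le> 1} x)"
  using integrable_square by (rule Bochner_Integration.integrable_bound) (auto split: split_indicator)

lemma integrable_core3: "integrable M (\<lambda>x. \<bar>x\<bar> ^ 3 * indicat_real {x. \<bar>x\<bar> \<le> 1} x)"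
  by (rule integrable_const_bound[of _ 1]) (auto split: split_indicator simp: power_le_one)

lemma tail2_nonneg: "tail2 \<ge> 0"
  unfolding tail2_def by (intro Bochner_Integration.integral_nonneg) auto

lemma core3_nonneg: "core3 \<ge> 0"
  unfolding core3_def by (intro Bochner_Integration.integral_nonneg) auto

lemma core2_eq: "(LINT x|M. x\<^sup>2 * indicat_real {x. \<bar>x\<bar> \<le> 1} x) = second_moment - tail2"
proof -
  have "(LINT x|M. x\<^sup>2 * indicat_real {x. \<bar>x\<bar> \<le> 1} x)
     = (LINT x|M. x\<^sup>2 - x\<^sup>2 * indicat_real {x. \<bar>x\<bar> > 1} x)"
    by (rule Bochner_Integration.integral_cong) (auto split: split_indicator)
  then show ?thesis
    using integrable_square integrable_tail2 by (simp add: second_moment_def tail2_def)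
qed

text \<open>A Lyapunov inequality, from \<open>3 l x\<^sup>2 \<le> 2 \<bar>x\<bar>\<^sup>3 + l\<^sup>3\<close> with \<open>l\<close> the square root of the
truncated second moment. It is what shows that small \<open>\<beta>\<close> forces \<open>n\<close> to be large.\<close>

lemma core2_le_core3: "(second_moment - tail2) ^ 3 \<le> core3\<^sup>2"
proof -
  let ?m = "second_moment - tail2"
  have m0: "?m \<ge> 0"
    unfolding core2_eq[symmetric] by (intro Bochner_Integration.integral_nonneg) auto
  define l where "l = sqrt ?m"
  have l: "l \<ge> 0" "l\<^sup>2 = ?m" using m0 by (auto simp: l_def)
  have "(LINT x|M. 3 * l * (x\<^sup>2 * indicat_real {x. \<bar>x\<bar> \<le> 1} x))
     \<le> (LINT x|M. 2 * (\<bar>x\<bar> ^ 3 * indicat_real {x. \<bar>x\<bar> \<le> 1} x) + l ^ 3)"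
  proof (rule integral_mono)
    fix x :: real
    have "0 \<le> (\<bar>x\<bar> - l)\<^sup>2 * (2 * \<bar>x\<bar> + l)" using l by simp
    also have "\<dots> = 2 * \<bar>x\<bar> ^ 3 + l ^ 3 - 3 * l * \<bar>x\<bar>\<^sup>2"
      by (simp add: power2_eq_square power3_eq_cube algebra_simps)
    finally have "3 * l * x\<^sup>2 \<le> 2 * \<bar>x\<bar> ^ 3 + l ^ 3" by simp
    then show "3 * l * (x\<^sup>2 * indicat_real {x. \<bar>x\<bar> \<le> 1} x)
      \<le> 2 * (\<bar>x\<bar> ^ 3 * indicat_real {x. \<bar>x\<bar> \<le> 1} x) + l ^ 3"
      using l by (auto split: split_indicator)
  qed (intro integrable_mult_right Bochner_Integration.integrable_add integrable_core2 integrable_core3 integrable_const)+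
  then have "3 * l * ?m \<le> 2 * core3 + l ^ 3"
    using integrable_core3 prob_space by (simp add: core2_eq core3_def del: space_eq_univ)
  then have "l ^ 3 \<le> core3" unfolding l(2)[symmetric] by (simp add: power2_eq_square power3_eq_cube)
  then have "(l ^ 3)\<^sup>2 \<le> core3\<^sup>2" using l by (intro power_mono) auto
  then show ?thesis unfolding l(2)[symmetric] by (simp add: power_mult[symmetric] mult.commute)
qed

text \<open>The form in which every Taylor remainder is used: the quadratic bound where \<open>\<bar>x\<bar> > 1\<close>, the
cubic one where \<open>\<bar>x\<bar> \<le> 1\<close>.\<close>

lemma cmod_integral_le:
  fixes f :: "real \<Rightarrow> complex"
  assumes [measurable]: "f \<in> borel_measurable borel"
    and "c2 \<ge> 0" "c3 \<ge> 0"
    and far: "\<And>x. cmod (f x) \<le> c2 * x\<^sup>2" and near: "\<And>x. cmod (f x) \<le> c3 * \<bar>x\<bar> ^ 3"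
  shows "cmod (CLINT x|M. f x) \<le> c2 * tail2 + c3 * core3"
proof -
  have "cmod (CLINT x|M. f x) \<le> (LINT x|M. cmod (f x))"
    by (rule integral_norm_bound)
  also have "\<dots> \<le> (LINT x|M. c2 * (x\<^sup>2 * indicat_real {x. \<bar>x\<bar> > 1} x) + c3 * (\<bar>x\<bar> ^ 3 * indicat_real {x. \<bar>x\<bar> \<le> 1} x))"
  proof (rule integral_mono)
    have "integrable M (\<lambda>x. c2 * x\<^sup>2)" using integrable_square by simp
    then show "integrable M (\<lambda>x. cmod (f x))"
      by (rule Bochner_Integration.integrable_bound)
         (use far in \<open>auto intro!: AE_I2 order_trans[OF _ abs_ge_self]\<close>)
    show "cmod (f x) \<le> c2 * (x\<^sup>2 * indicat_real {x. \<bar>x\<bar> > 1} x) + c3 * (\<bar>x\<bar> ^ 3 * indicat_real {x. \<bar>x\<bar> \<le> 1} x)" for x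
      using far[of x] near[of x] by (auto split: split_indicator)
  qed (intro integrable_mult_right Bochner_Integration.integrable_add integrable_tail2 integrable_core3)
  also have "\<dots> = c2 * tail2 + c3 * core3"
    using integrable_tail2 integrable_core3 by (simp add: tail2_def core3_def)
  finally show ?thesis .
qed

lemma integrable_iexp_mult: "integrable M (\<lambda>x. iexp (t * x))"
  by (rule integrable_iexp) auto

lemma char_minus_one:
  assumes "t \<ge> 0" shows "cmod (char M t - 1) \<le> t\<^sup>2 * second_moment / 2"
proof -
  have "char M t - 1 = (CLINT x|M. iexp (t * x) - 1 - \<i> * t * x)"
    using integrable_iexp_mult[of t] integrable_id mean_zero prob_space
    by (simp add: char_def del: space_eq_univ)
  also have "cmod \<dots> \<le> (LINT x|M. cmod (iexp (t * x) - 1 - \<i> * t * x))"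
    by (rule integral_norm_bound)
  also have "\<dots> \<le> (LINT x|M. t\<^sup>2 / 2 * x\<^sup>2)"
  proof (rule integral_mono)
    show "integrable M (\<lambda>x. cmod (iexp (t * x) - 1 - \<i> * t * x))"
      using integrable_iexp_mult[of t] integrable_id by (intro integrable_norm) simp
    show "cmod (iexp (t * x) - 1 - \<i> * t * x) \<le> t\<^sup>2 / 2 * x\<^sup>2" for x
      using cmod_iexp_order1(1)[of "t * x"] by (simp add: power_mult_distrib algebra_simps)
  qed (use integrable_square in simp)
  also have "\<dots> = t\<^sup>2 * second_moment / 2" by (simp add: second_moment_def)
  finally show ?thesis .
qed

lemma char_second_order:
  assumes "t \<ge> 0"
  shows "cmod (char M t - (1 - t\<^sup>2 * second_moment / 2)) \<le> t\<^sup>2 * tail2 + t ^ 3 / 6 * core3"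
proof -
  define f where "f x = iexp (t * x) - (1 + \<i> * (t * x) - (t * x)\<^sup>2 / 2)" for x
  have f_eq: "f x = iexp (t * x) - 1 - (\<i> * t) * complex_of_real x + complex_of_real (t\<^sup>2 / 2) * complex_of_real (x\<^sup>2)" for x
    by (simp add: f_def power_mult_distrib)
  have i: "integrable M (\<lambda>x. complex_of_real x)" "integrable M (\<lambda>x. complex_of_real (x\<^sup>2))"
    by (intro integrable_of_real integrable_id integrable_square)+
  have v: "(CLINT x|M. complex_of_real x) = 0" "(CLINT x|M. complex_of_real (x\<^sup>2)) = complex_of_real second_moment"
    unfolding integral_complex_of_real second_moment_def mean_zero by simp_all
  have "(CLINT x|M. f x) = char M t - 1 - (\<i> * t) * 0 + complex_of_real (t\<^sup>2 / 2) * complex_of_real second_moment"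
    unfolding f_eq char_def v[symmetric] using i integrable_iexp_mult[of t] prob_space
    by (simp del: space_eq_univ of_real_power of_real_divide of_real_mult)
  then have "char M t - (1 - t\<^sup>2 * second_moment / 2) = (CLINT x|M. f x)"
    by simp
  moreover have "cmod (CLINT x|M. f x) \<le> t\<^sup>2 * tail2 + t ^ 3 / 6 * core3"
  proof (rule cmod_integral_le)
    show "f \<in> borel_measurable borel" unfolding f_def[abs_def] by measurable
    show "cmod (f x) \<le> t\<^sup>2 * x\<^sup>2" for x
      unfolding f_def using cmod_iexp_order2(2)[of "t * x"] by (simp only: power_mult_distrib)
    show "cmod (f x) \<le> t ^ 3 / 6 * \<bar>x\<bar> ^ 3" for x
    proof -
      have "cmod (f x) \<le> \<bar>t * x\<bar> ^ 3 / 6" unfolding f_def by (rule cmod_iexp_order2(1))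
      also have "\<dots> = t ^ 3 / 6 * \<bar>x\<bar> ^ 3" using assms by (simp add: power_mult_distrib abs_mult)
      finally show ?thesis .
    qed
  qed (use assms in auto)
  ultimately show ?thesis by (simp only:)
qed

text \<open>Up to powers of \<open>\<i>\<close>, the first derivative of the characteristic function, and the second one with large
values of \<open>x\<close> removed.\<close>

definition char1 :: "real \<Rightarrow> complex" where
  "char1 t = (CLINT x|M. x * iexp (t * x))"

definition char2 :: "real \<Rightarrow> complex" where
  "char2 t = (CLINT x|M. (x\<^sup>2 * indicat_real {x. \<bar>x\<bar> \<le> 1} x) * iexp (t * x))"

lemma integrable_times_iexp:
  assumes "integrable M f" shows "integrable M (\<lambda>x. complex_of_real (f x) * iexp (t * x))"
  using assms by (rule Bochner_Integration.integrable_bound)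
    (use assms in \<open>auto simp: norm_mult simp del: of_real_mult\<close>)

lemma char1_first_order:
  assumes "t \<ge> 0"
  shows "cmod (char1 t - \<i> * t * second_moment) \<le> 2 * t * tail2 + t\<^sup>2 / 2 * core3"
proof -
  define f where "f x = complex_of_real x * (iexp (t * x) - (1 + \<i> * (t * x)))" for x
  have f_eq: "f x = x * iexp (t * x) - complex_of_real x - (\<i> * t) * complex_of_real (x\<^sup>2)" for x
    by (simp add: f_def power2_eq_square right_diff_distrib distrib_left)
  have i: "integrable M (\<lambda>x. complex_of_real x)" "integrable M (\<lambda>x. complex_of_real (x\<^sup>2))"
    by (intro integrable_of_real integrable_id integrable_square)+
  have v: "(CLINT x|M. complex_of_real x) = 0" "(CLINT x|M. complex_of_real (x\<^sup>2)) = complex_of_real second_moment"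
    unfolding integral_complex_of_real second_moment_def mean_zero by simp_all
  have "(CLINT x|M. f x) = char1 t - 0 - (\<i> * t) * complex_of_real second_moment"
    unfolding f_eq char1_def v[symmetric] using i integrable_times_iexp[OF integrable_id, of t]
    by (simp del: of_real_power of_real_mult)
  then have "char1 t - \<i> * t * second_moment = (CLINT x|M. f x)"
    by simp
  moreover have "cmod (CLINT x|M. f x) \<le> 2 * t * tail2 + t\<^sup>2 / 2 * core3"
  proof (rule cmod_integral_le)
    show "f \<in> borel_measurable borel" unfolding f_def[abs_def] by measurable
    show "cmod (f x) \<le> 2 * t * x\<^sup>2" for x
    proof -
      have "cmod (f x) \<le> \<bar>x\<bar> * (2 * \<bar>t * x\<bar>)"
        unfolding f_def norm_mult norm_of_real by (intro mult_left_mono cmod_iexp_order1) simp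
      also have "\<dots> = 2 * t * x\<^sup>2" using assms by (simp add: abs_mult power2_eq_square)
      finally show ?thesis .
    qed
    show "cmod (f x) \<le> t\<^sup>2 / 2 * \<bar>x\<bar> ^ 3" for x
    proof -
      have "cmod (f x) \<le> \<bar>x\<bar> * ((t * x)\<^sup>2 / 2)"
        unfolding f_def norm_mult norm_of_real by (intro mult_left_mono cmod_iexp_order1) simp
      also have "\<dots> = t\<^sup>2 / 2 * (\<bar>x\<bar> * \<bar>x\<bar>\<^sup>2)" by (simp add: power_mult_distrib)
      also have "\<bar>x\<bar> * \<bar>x\<bar>\<^sup>2 = \<bar>x\<bar> ^ 3" by (simp only: power3_eq_cube power2_eq_square mult.assoc)
      finally show ?thesis .
    qed
  qed (use assms in auto)
  ultimately show ?thesis by (simp only:)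
qed

lemma char2_zeroth_order:
  assumes "t \<ge> 0" shows "cmod (char2 t - (second_moment - tail2)) \<le> t * core3"
proof -
  let ?q = "\<lambda>x. x\<^sup>2 * indicat_real {x. \<bar>x\<bar> \<le> 1} x"
  define f where "f x = complex_of_real (?q x) * (iexp (t * x) - 1)" for x
  have f_eq: "f x = complex_of_real (?q x) * iexp (t * x) - complex_of_real (?q x)" for x
    by (simp only: f_def right_diff_distrib mult_1_right)
  have i: "integrable M (\<lambda>x. complex_of_real (?q x))"
    by (intro integrable_of_real integrable_core2)
  have fi: "integrable M f"
    unfolding f_eq by (intro Bochner_Integration.integrable_diff integrable_times_iexp integrable_core2 i)
  have "(CLINT x|M. f x) = char2 t - complex_of_real (second_moment - tail2)"
    unfolding f_eq char2_def core2_eq[symmetric] integral_complex_of_real[symmetric]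
    by (rule Bochner_Integration.integral_diff[OF integrable_times_iexp[OF integrable_core2] i])
  moreover have "cmod (CLINT x|M. f x) \<le> t * core3"
  proof -
    have "cmod (CLINT x|M. f x) \<le> (LINT x|M. cmod (f x))"
      by (rule integral_norm_bound)
    also have "\<dots> \<le> (LINT x|M. t * (\<bar>x\<bar> ^ 3 * indicat_real {x. \<bar>x\<bar> \<le> 1} x))"
    proof (rule integral_mono)
      show "integrable M (\<lambda>x. cmod (f x))" using fi by (rule integrable_norm)
      show "cmod (f x) \<le> t * (\<bar>x\<bar> ^ 3 * indicat_real {x. \<bar>x\<bar> \<le> 1} x)" for x
      proof -
        have "cmod (f x) \<le> \<bar>?q x\<bar> * \<bar>t * x\<bar>"
          unfolding f_def norm_mult norm_of_real by (intro mult_left_mono cmod_iexp_minus_1) simp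
        also have "\<dots> = t * (\<bar>x\<bar> ^ 3 * indicat_real {x. \<bar>x\<bar> \<le> 1} x)"
          using assms by (simp add: abs_mult power3_eq_cube power2_eq_square)
        finally show ?thesis .
      qed
    qed (intro integrable_mult_right integrable_core3)
    also have "\<dots> = t * core3" by (simp add: core3_def)
    finally show ?thesis .
  qed
  ultimately show ?thesis by (simp only:)
qed

lemma cmod_char_le_exp:
  assumes "t \<ge> 0" "t\<^sup>2 * second_moment / 2 \<le> 1"
  shows "cmod (char M t) \<le> exp (- (t\<^sup>2 * second_moment / 2) + (t\<^sup>2 * tail2 + t ^ 3 / 6 * core3))"
proof -
  let ?x = "t\<^sup>2 * second_moment / 2" and ?y = "t\<^sup>2 * tail2 + t ^ 3 / 6 * core3"
  have "cmod (char M t) \<le> cmod (complex_of_real (1 - ?x)) + ?y"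
    using char_second_order[OF assms(1)] norm_triangle_sub[of "char M t" "complex_of_real (1 - ?x)"] by simp
  also have "cmod (complex_of_real (1 - ?x)) = 1 - ?x"
    unfolding norm_of_real using assms(2) by simp
  also have "1 - ?x + ?y = 1 + (- ?x + ?y)"
    by (simp only: add.assoc diff_conv_add_uminus)
  also have "\<dots> \<le> exp (- ?x + ?y)"
    by (rule exp_ge_add_one_self)
  finally show ?thesis .
qed

end

section \<open>Powers of the characteristic function\<close>

text \<open>One of \<open>n\<close> identically distributed summands whose variances add up to one; \<open>B2\<close> and \<open>B3\<close> are
then \<open>\<beta>\<^sub>2\<close> and \<open>\<beta>\<^sub>3\<close>.\<close>

locale centered_summand = centered_distribution +
  fixes n :: nat and B2 B3 :: real
  assumes n_variance: "real n * second_moment = 1"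
    and B2_eq: "B2 = real n * tail2" and B3_eq: "B3 = real n * core3"
begin

lemma n_pos: "n > 0"
  using n_variance by (cases n) auto

lemma second_moment_eq: "second_moment = 1 / real n"
  using n_variance n_pos by (simp add: field_simps)

lemma tail2_eq: "tail2 = B2 / real n"
  using n_pos by (simp add: B2_eq)

lemma core3_eq: "core3 = B3 / real n"
  using n_pos by (simp add: B3_eq)

lemma B2_nonneg: "B2 \<ge> 0" and B3_nonneg: "B3 \<ge> 0"
  using tail2_nonneg core3_nonneg by (auto simp: B2_eq B3_eq)

lemma B2_le_1: "B2 \<le> 1"
proof -
  have "0 \<le> second_moment - tail2"
    unfolding core2_eq[symmetric] by (intro Bochner_Integration.integral_nonneg) auto
  then show ?thesis
    using n_pos by (simp add: second_moment_eq tail2_eq field_simps)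
qed

lemma cube_le_n_B3_sq: "(1 - B2) ^ 3 \<le> real n * B3\<^sup>2"
proof -
  have "real n ^ 3 * (second_moment - tail2) ^ 3 \<le> real n ^ 3 * core3\<^sup>2"
    using core2_le_core3 by (intro mult_left_mono) auto
  also have "real n ^ 3 * (second_moment - tail2) ^ 3 = (1 - B2) ^ 3"
    by (simp add: power_mult_distrib[symmetric] right_diff_distrib n_variance B2_eq)
  also have "real n ^ 3 * core3\<^sup>2 = real n * B3\<^sup>2"
    by (simp add: B3_eq power3_eq_cube power2_eq_square)
  finally show ?thesis .
qed

text \<open>The terms of order \<open>1 / n\<close> in the expansions are thereby of second order in \<open>\<beta>\<close>.\<close>

lemma inverse_n_le:
  assumes "B2 + B3 \<le> b" "b \<le> 1" "c * (1 - b) ^ 3 \<ge> 1" "c \<ge> 0"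
  shows "1 / real n \<le> c * (B2 + B3)\<^sup>2"
proof -
  have "B2 \<le> b" "b \<ge> 0" using assms B2_nonneg B3_nonneg by auto
  then have "(1 - b) ^ 3 \<le> (1 - B2) ^ 3" using assms by (intro power_mono) auto
  also have "\<dots> \<le> real n * B3\<^sup>2" by (rule cube_le_n_B3_sq)
  also have "\<dots> \<le> real n * (B2 + B3)\<^sup>2"
    using B2_nonneg B3_nonneg by (intro mult_left_mono power_mono) auto
  finally have "c * (1 - b) ^ 3 \<le> c * (real n * (B2 + B3)\<^sup>2)"
    using assms by (intro mult_left_mono) auto
  with assms have "1 \<le> c * (real n * (B2 + B3)\<^sup>2)" by linarith
  then show ?thesis using n_pos by (simp add: field_simps)
qed

lemma beta_pos: "B2 + B3 > 0"
proof (rule ccontr)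
  assume "\<not> ?thesis"
  then have "B2 = 0" "B3 = 0" using B2_nonneg B3_nonneg by auto
  with cube_le_n_B3_sq show False by simp
qed

lemma cmod_char_le:
  assumes t: "t \<ge> 0" "t\<^sup>2 \<le> 2 * real n"
    and \<theta>: "\<theta> \<le> 1 / 2 - B2 - t * B3 / 6"
  shows "cmod (char M t) \<le> exp (- (\<theta> * t\<^sup>2 / real n))"
proof -
  have "cmod (char M t) \<le> exp (- (t\<^sup>2 * second_moment / 2) + (t\<^sup>2 * tail2 + t ^ 3 / 6 * core3))"
    using t n_pos by (intro cmod_char_le_exp) (auto simp: second_moment_eq field_simps)
  also have "- (t\<^sup>2 * second_moment / 2) + (t\<^sup>2 * tail2 + t ^ 3 / 6 * core3)
     = - ((1 / 2 - B2 - t * B3 / 6) * t\<^sup>2 / real n)"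
    using n_pos by (simp add: second_moment_eq tail2_eq core3_eq field_simps power2_eq_square power3_eq_cube)
  also have "exp \<dots> \<le> exp (- (\<theta> * t\<^sup>2 / real n))"
    using \<theta> n_pos by (simp add: divide_right_mono mult_right_mono)
  finally show ?thesis .
qed

text \<open>Telescoping \<open>z\<^sup>n - w\<^sup>n\<close> with \<open>z = \<phi> t\<close> and \<open>w = exp (- t\<^sup>2 / (2 n))\<close>, both at most
\<open>exp (- \<theta> t\<^sup>2 / n)\<close> in modulus.\<close>

lemma char_power_approx:
  assumes t: "t \<ge> 0" "t\<^sup>2 \<le> 2 * real n"
    and \<theta>: "\<theta> \<le> 1 / 2 - B2 - t * B3 / 6"
  shows "cmod (char M t ^ n - exp (- (t\<^sup>2 / 2)))
    \<le> exp (- (\<theta> * t\<^sup>2 * (1 - 1 / real n))) * (t\<^sup>2 * B2 + t ^ 3 / 6 * B3 + t ^ 4 / (8 * real n))"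
proof -
  let ?z = "char M t" and ?w = "complex_of_real (exp (- (t\<^sup>2 / (2 * real n))))"
  let ?q = "exp (- (\<theta> * t\<^sup>2 / real n))"
  have "0 \<le> t * B3" using t B3_nonneg by simp
  then have half: "\<theta> \<le> 1 / 2" using \<theta> B2_nonneg by linarith
  have z: "cmod ?z \<le> ?q" by (rule cmod_char_le[OF assms])
  have "\<theta> * t\<^sup>2 / real n \<le> (1 / 2) * t\<^sup>2 / real n"
    using half by (intro divide_right_mono mult_right_mono) auto
  then have w: "cmod ?w \<le> ?q" by simp
  have wn: "?w ^ n = exp (- (t\<^sup>2 / 2))"
    using n_pos unfolding of_real_power[symmetric] exp_of_nat_mult[symmetric] by (simp flip: exp_of_real)
  have qn: "?q ^ (n - 1) = exp (- (\<theta> * t\<^sup>2 * (1 - 1 / real n)))"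
    using n_pos unfolding exp_of_nat_mult[symmetric]
    by (simp add: of_nat_diff field_simps)
  have "cmod (?z - ?w) \<le> cmod (?z - (1 - t\<^sup>2 * second_moment / 2)) + cmod ((1 - t\<^sup>2 * second_moment / 2) - ?w)"
    by (rule norm_diff_triangle_ineq[THEN order_trans[rotated], OF eq_refl, OF arg_cong[where f = norm]]) simp
  also have "cmod ((1 - t\<^sup>2 * second_moment / 2) - ?w) = cmod (complex_of_real ((1 - t\<^sup>2 / (2 * real n)) - exp (- (t\<^sup>2 / (2 * real n)))))"
    by (simp add: second_moment_eq mult.commute)
  also have "\<dots> = \<bar>exp (- (t\<^sup>2 / (2 * real n))) - (1 - t\<^sup>2 / (2 * real n))\<bar>"
    unfolding norm_of_real by (rule abs_minus_commute)
  also have "\<dots> \<le> (t\<^sup>2 / (2 * real n))\<^sup>2 / 2"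
    by (rule exp_minus_second_order) simp
  also have "cmod (?z - (1 - t\<^sup>2 * second_moment / 2)) \<le> t\<^sup>2 * tail2 + t ^ 3 / 6 * core3"
    by (rule char_second_order[OF t(1)])
  finally have zw: "cmod (?z - ?w) \<le> (t\<^sup>2 * tail2 + t ^ 3 / 6 * core3) + (t\<^sup>2 / (2 * real n))\<^sup>2 / 2"
    by simp
  have "cmod (?z ^ n - ?w ^ n) \<le> real n * ?q ^ (n - 1) * cmod (?z - ?w)"
    by (rule norm_power_diff_le[OF z w])
  also have "\<dots> \<le> real n * ?q ^ (n - 1) * ((t\<^sup>2 * tail2 + t ^ 3 / 6 * core3) + (t\<^sup>2 / (2 * real n))\<^sup>2 / 2)"
    by (intro mult_left_mono zw) simp
  also have "\<dots> = ?q ^ (n - 1) * (t\<^sup>2 * B2 + t ^ 3 / 6 * B3 + t ^ 4 / (8 * real n))"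
    using n_pos by (simp add: tail2_eq core3_eq field_simps power2_eq_square power4_eq_xxxx)
  finally show ?thesis unfolding wn qn .
qed

text \<open>The range \<open>t \<le> 6 / (5 \<beta>)\<close> balances the two error terms in the smoothing inequality: a larger
constant shrinks the term of order \<open>1 / T\<close> but weakens the Gaussian factor \<open>exp (- 6 t\<^sup>2 / 25)\<close>. The factor next
to \<open>t\<close> on the right contains odd powers only, which gives it an elementary primitive.\<close>

lemma char_power_approx_small:
  assumes b: "B2 + B3 \<le> 11 / 200" and t: "0 < t" "t \<le> 6 / (5 * (B2 + B3))"
  shows "cmod (char M t ^ n - exp (- (t\<^sup>2 / 2)))
    \<le> t * (((B2 + B3 / 4) * t + (B3 / 36 + 3 / 20 * (B2 + B3)\<^sup>2) * t ^ 3) * exp (- (6 / 25 * t\<^sup>2)))"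
proof -
  let ?b = "B2 + B3"
  have n: "1 / real n \<le> 6 / 5 * ?b\<^sup>2"
    by (rule inverse_n_le[OF b]) (simp_all add: power3_eq_cube)
  have tb: "t * ?b \<le> 6 / 5" using t beta_pos by (simp add: field_simps)
  have "?b\<^sup>2 \<le> (11 / 200)\<^sup>2" using b beta_pos by (intro power_mono) auto
  then have n2: "1 / real n \<le> 1 / 50" using n by (simp add: power2_eq_square)
  have "t\<^sup>2 / real n \<le> t\<^sup>2 * (6 / 5 * ?b\<^sup>2)"
    using mult_left_mono[OF n, of "t\<^sup>2"] by simp
  also have "\<dots> = 6 / 5 * (t * ?b)\<^sup>2" by (simp add: power_mult_distrib)
  also have "\<dots> \<le> 6 / 5 * (6 / 5)\<^sup>2" using tb t beta_pos by (intro mult_left_mono power_mono) auto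
  also have "\<dots> \<le> 2" by (simp add: power2_eq_square)
  finally have tn: "t\<^sup>2 \<le> 2 * real n" using n_pos by (simp add: field_simps)
  have "t * B3 \<le> t * ?b" using t B2_nonneg by (intro mult_left_mono) auto
  then have \<theta>: "49 / 200 \<le> 1 / 2 - B2 - t * B3 / 6"
    using tb b B3_nonneg by linarith
  have "6 / 25 * t\<^sup>2 \<le> (49 / 200 * (1 - 1 / real n)) * t\<^sup>2"
    using n2 by (intro mult_right_mono) auto
  then have e: "exp (- (49 / 200 * t\<^sup>2 * (1 - 1 / real n))) \<le> exp (- (6 / 25 * t\<^sup>2))"
    by (simp add: mult.commute mult.left_commute)
  \<comment> \<open>trades the even power of \<open>t\<close> for odd ones\<close>
  have "0 \<le> t * (1 / 2 - t / 6)\<^sup>2" using t by simp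
  then have amgm: "t\<^sup>2 / 6 \<le> t / 4 + t ^ 3 / 36"
    by (simp add: power2_eq_square power3_eq_cube algebra_simps)
  have "t\<^sup>2 * B2 + t ^ 3 / 6 * B3 + t ^ 4 / (8 * real n)
      = t * (t * B2 + (t\<^sup>2 / 6) * B3 + t ^ 3 / 8 * (1 / real n))"
    by (simp add: power2_eq_square power3_eq_cube power4_eq_xxxx algebra_simps)
  also have "\<dots> \<le> t * (t * B2 + (t / 4 + t ^ 3 / 36) * B3 + t ^ 3 / 8 * (6 / 5 * ?b\<^sup>2))"
    using t amgm n B3_nonneg by (intro mult_left_mono add_mono mult_right_mono order_refl) auto
  also have "\<dots> = t * ((B2 + B3 / 4) * t + (B3 / 36 + 3 / 20 * (B2 + B3)\<^sup>2) * t ^ 3)"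
    by (simp add: algebra_simps)
  finally have poly: "t\<^sup>2 * B2 + t ^ 3 / 6 * B3 + t ^ 4 / (8 * real n)
      \<le> t * ((B2 + B3 / 4) * t + (B3 / 36 + 3 / 20 * (B2 + B3)\<^sup>2) * t ^ 3)" .
  have pos: "0 \<le> t\<^sup>2 * B2 + t ^ 3 / 6 * B3 + t ^ 4 / (8 * real n)"
    using t B2_nonneg B3_nonneg by simp
  have "cmod (char M t ^ n - exp (- (t\<^sup>2 / 2)))
    \<le> exp (- (49 / 200 * t\<^sup>2 * (1 - 1 / real n))) * (t\<^sup>2 * B2 + t ^ 3 / 6 * B3 + t ^ 4 / (8 * real n))"
    using t by (intro char_power_approx tn \<theta>) auto
  also have "\<dots> \<le> exp (- (6 / 25 * t\<^sup>2)) * (t * ((B2 + B3 / 4) * t + (B3 / 36 + 3 / 20 * (B2 + B3)\<^sup>2) * t ^ 3))"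
    by (intro mult_mono e poly pos) simp
  finally show ?thesis by (simp only: mult.commute mult.left_commute)
qed

text \<open>The left-hand side compares the transforms of the weights \<open>core_weight\<close> and
\<open>z\<^sup>2 - \<beta>\<^sub>2\<close>, see \<open>core_weight_char\<close> and \<open>std_normal_square_char\<close> below. The difference vanishes at \<open>t = 0\<close> and is
\<open>O(t \<beta>)\<close>, which is what \<open>fejer_weighted_difference\<close> asks for.\<close>

lemma weighted_char_approx_small:
  assumes b: "B2 + B3 \<le> 1 / 100" and t: "0 < t" "t \<le> 1 / (B2 + B3)"
  shows "cmod ((of_nat n * char2 t * char M t ^ (n - 1) + of_nat n * of_nat (n - 1) * (char1 t)\<^sup>2 * char M t ^ (n - 2))
      - (1 - B2 - t\<^sup>2) * exp (- (t\<^sup>2 / 2)))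
    \<le> t * ((B2 + B3) * ((1 + 9 * t + 5 / 2 * t\<^sup>2 + 3 * t ^ 3 + t ^ 4 + t ^ 5) * exp (- (t\<^sup>2 / 4))))"
proof -
  let ?b = "B2 + B3"
  let ?E = "exp (- (t\<^sup>2 / 4))"
  let ?e = "complex_of_real (exp (- (t\<^sup>2 / 2)))"
  let ?\<phi> = "char M t"
  have b0: "?b > 0" by (rule beta_pos)
  have n: "1 / real n \<le> 11 / 10 * ?b\<^sup>2"
    by (rule inverse_n_le[OF b]) (simp_all add: power3_eq_cube)
  have "?b * ?b \<le> 1 / 100 * ?b" using b b0 by (intro mult_right_mono) auto
  then have nb: "1 / real n \<le> ?b / 50"
  proof -
    have lin: "x \<le> 11 / 10 * s \<Longrightarrow> s \<le> 1 / 100 * c \<Longrightarrow> c > 0 \<Longrightarrow> x \<le> c / 50" for x s c :: real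
      by linarith
    show ?thesis by (rule lin[OF n[unfolded power2_eq_square] \<open>?b * ?b \<le> 1 / 100 * ?b\<close> b0])
  qed
  have n2: "1 / real n \<le> 1 / 1000" using nb b by simp
  have n2': "2 \<le> n"
  proof -
    have "1000 \<le> real n" using n2 n_pos by (simp add: field_simps)
    then show ?thesis by simp
  qed
  have tb: "t * ?b \<le> 1" using t b0 by (simp add: field_simps)
  have "t\<^sup>2 / real n \<le> t\<^sup>2 * (11 / 10 * ?b\<^sup>2)"
    using mult_left_mono[OF n, of "t\<^sup>2"] by simp
  also have "\<dots> = 11 / 10 * (t * ?b)\<^sup>2" by (simp add: power_mult_distrib)
  also have "\<dots> \<le> 11 / 10 * 1\<^sup>2" using tb t b0 by (intro mult_left_mono power_mono) auto
  finally have tn': "t\<^sup>2 / real n \<le> 11 / 10" by simp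
  then have tn: "t\<^sup>2 \<le> 2 * real n" using n_pos by (simp add: field_simps)
  have tB3: "t * B3 \<le> t * ?b" using t B2_nonneg by (intro mult_left_mono) auto
  then have \<theta>: "32 / 100 \<le> 1 / 2 - B2 - t * B3 / 6"
    using tb b B3_nonneg by linarith
  have \<phi>1: "cmod ?\<phi> \<le> 1" by (rule cmod_char_le_1)
  have \<phi>k: "cmod ?\<phi> ^ m \<le> ?E" if "m \<ge> n - 2" for m
  proof -
    have "cmod ?\<phi> ^ m \<le> cmod ?\<phi> ^ (n - 2)" using \<phi>1 that by (intro power_decreasing) auto
    also have "\<dots> \<le> exp (- (32 / 100 * t\<^sup>2 / real n)) ^ (n - 2)"
      using t tn \<theta> by (intro power_mono cmod_char_le) auto
    also have "\<dots> = exp (- (32 / 100 * t\<^sup>2 * (1 - 2 * (1 / real n))))"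
      using n_pos n2' unfolding exp_of_nat_mult[symmetric] by (simp add: of_nat_diff field_simps)
    also have "\<dots> \<le> ?E"
    proof -
      have "1 / 4 * t\<^sup>2 \<le> (32 / 100 * (1 - 2 * (1 / real n))) * t\<^sup>2"
        using n2 by (intro mult_right_mono) auto
      also have "\<dots> = 32 / 100 * t\<^sup>2 * (1 - 2 * (1 / real n))"
        by (simp only: mult.assoc mult.commute[of "t\<^sup>2"])
      finally show ?thesis unfolding exp_le_cancel_iff neg_le_iff_le by simp
    qed
    finally show ?thesis .
  qed
  have eE: "exp (- (t\<^sup>2 / 2)) \<le> ?E" by simp
  have c1: "cmod (?\<phi> - 1) \<le> t\<^sup>2 / 2 * ?b"
  proof -
    have "cmod (?\<phi> - 1) \<le> t\<^sup>2 * second_moment / 2" using t by (intro char_minus_one) auto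
    also have "\<dots> = t\<^sup>2 / 2 * (1 / real n)" by (simp add: second_moment_eq)
    also have "\<dots> \<le> t\<^sup>2 / 2 * ?b" using nb b0 by (intro mult_left_mono) auto
    finally show ?thesis .
  qed
  have D0: "cmod (?\<phi> ^ n - ?e) \<le> ?E * (?b * (t\<^sup>2 + t ^ 3 + t ^ 4))"
  proof -
    have "cmod (?\<phi> ^ n - ?e)
      \<le> exp (- (32 / 100 * t\<^sup>2 * (1 - 1 / real n))) * (t\<^sup>2 * B2 + t ^ 3 / 6 * B3 + t ^ 4 / (8 * real n))"
      using t by (intro char_power_approx tn \<theta>) auto
    also have "\<dots> \<le> ?E * (?b * (t\<^sup>2 + t ^ 3 + t ^ 4))"
    proof (rule mult_mono)
      have "1 / 4 * t\<^sup>2 \<le> (32 / 100 * (1 - 1 / real n)) * t\<^sup>2"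
        using n2 by (intro mult_right_mono) auto
      also have "\<dots> = 32 / 100 * t\<^sup>2 * (1 - 1 / real n)"
        by (simp only: mult.assoc mult.commute[of "t\<^sup>2"])
      finally show "exp (- (32 / 100 * t\<^sup>2 * (1 - 1 / real n))) \<le> ?E"
        unfolding exp_le_cancel_iff neg_le_iff_le by simp
      have "t\<^sup>2 * B2 \<le> t\<^sup>2 * ?b" using B3_nonneg by (intro mult_left_mono) auto
      moreover have "t ^ 3 / 6 * B3 \<le> t ^ 3 * ?b" using B2_nonneg B3_nonneg t by (intro mult_mono) auto
      moreover have "t ^ 4 / 8 * (1 / real n) \<le> t ^ 4 * ?b"
        using nb b0 t by (intro mult_mono) auto
      ultimately show "t\<^sup>2 * B2 + t ^ 3 / 6 * B3 + t ^ 4 / (8 * real n) \<le> ?b * (t\<^sup>2 + t ^ 3 + t ^ 4)"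
        by (simp add: algebra_simps)
    qed (use t B2_nonneg B3_nonneg in auto)
    finally show ?thesis .
  qed
  have D: "cmod (?\<phi> ^ (n - k) - ?e) \<le> ?E * (?b * (2 * t\<^sup>2 + t ^ 3 + t ^ 4))" if k: "k = 1 \<or> k = 2" for k
  proof -
    have "?\<phi> ^ (n - k) - ?e = ?\<phi> ^ (n - k) * (1 - ?\<phi> ^ k) + (?\<phi> ^ n - ?e)"
    proof -
      have "?\<phi> ^ n = ?\<phi> ^ (n - k) * ?\<phi> ^ k"
      proof -
        have "n - k + k = n" using k n2' by auto
        then show ?thesis by (simp only: power_add[symmetric])
      qed
      then show ?thesis by (simp add: right_diff_distrib)
    qed
    then have "cmod (?\<phi> ^ (n - k) - ?e) \<le> cmod (?\<phi> ^ (n - k) * (1 - ?\<phi> ^ k)) + cmod (?\<phi> ^ n - ?e)"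
      by (metis norm_triangle_ineq)
    also have "cmod (?\<phi> ^ (n - k) * (1 - ?\<phi> ^ k)) \<le> ?E * (t\<^sup>2 * ?b)"
      unfolding norm_mult norm_power
    proof (rule mult_mono)
      show "cmod ?\<phi> ^ (n - k) \<le> ?E" using k by (intro \<phi>k) auto
      have "cmod (1 - ?\<phi> ^ k) = cmod (?\<phi> ^ k - 1 ^ k)" by (simp add: norm_minus_commute)
      also have "\<dots> \<le> real k * 1 ^ (k - 1) * cmod (?\<phi> - 1)"
        by (rule norm_power_diff_le) (use \<phi>1 in auto)
      also have "\<dots> \<le> 2 * (t\<^sup>2 / 2 * ?b)"
        using k c1 by (intro mult_mono) auto
      finally show "cmod (1 - ?\<phi> ^ k) \<le> t\<^sup>2 * ?b" by simp
    qed auto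
    finally show ?thesis using D0 by (simp add: algebra_simps)
  qed
  \<comment> \<open>the errors of \<open>n char2\<close> and \<open>n char1\<close> against their leading terms \<open>1 - \<beta>\<^sub>2\<close> and \<open>i t\<close>\<close>
  define r2 where "r2 = of_nat n * char2 t - complex_of_real (1 - B2)"
  define r1 where "r1 = of_nat n * char1 t - \<i> * t"
  have r2: "cmod r2 \<le> t * ?b"
  proof -
    have "r2 = of_nat n * (char2 t - (second_moment - tail2))"
      using n_pos by (simp add: r2_def second_moment_eq tail2_eq field_simps)
    then have "cmod r2 = real n * cmod (char2 t - (second_moment - tail2))"
      by (simp only: norm_mult norm_of_nat)
    also have "\<dots> \<le> real n * (t * core3)"
      using t by (intro mult_left_mono char2_zeroth_order) auto
    also have "\<dots> = t * B3" by (simp add: B3_eq)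
    finally show ?thesis using tB3 by linarith
  qed
  have r1: "cmod r1 \<le> t * (?b * (2 + t / 2))" "cmod r1 \<le> t"
  proof -
    have "r1 = of_nat n * (char1 t - \<i> * t * second_moment)"
      using n_pos by (simp add: r1_def second_moment_eq field_simps)
    then have "cmod r1 = real n * cmod (char1 t - \<i> * t * second_moment)"
      by (simp only: norm_mult norm_of_nat)
    also have "\<dots> \<le> real n * (2 * t * tail2 + t\<^sup>2 / 2 * core3)"
      using t by (intro mult_left_mono char1_first_order) auto
    also have "\<dots> = t * (2 * B2 + t * B3 / 2)" by (simp add: B3_eq B2_eq power2_eq_square algebra_simps)
    finally have *: "cmod r1 \<le> t * (2 * B2 + t * B3 / 2)" .
    have "2 * B2 + t * B3 / 2 \<le> ?b * (2 + t / 2)"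
    proof -
      have "?b * (2 + t / 2) = 2 * B2 + t * B3 / 2 + (2 * B3 + t * B2 / 2)"
        by (simp add: field_simps)
      moreover have "0 \<le> 2 * B3 + t * B2 / 2" using t B3_nonneg B2_nonneg by simp
      ultimately show ?thesis by linarith
    qed
    then show "cmod r1 \<le> t * (?b * (2 + t / 2))"
      using * t by (meson less_imp_le mult_left_mono order_trans)
    have "2 * B2 + t * B3 / 2 \<le> 1" using tB3 tb b B3_nonneg by linarith
    then have "t * (2 * B2 + t * B3 / 2) \<le> t * 1" using t by (intro mult_left_mono) auto
    with * show "cmod r1 \<le> t" by linarith
  qed
  let ?c = "complex_of_real (1 - 1 / real n)"
  have c: "cmod ?c \<le> 1" unfolding norm_of_real using n2 n_pos by simp
  have sq: "of_nat n * of_nat (n - 1) * (char1 t)\<^sup>2 = ?c * (of_nat n * char1 t)\<^sup>2"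
    using n2' by (simp add: of_nat_diff power_mult_distrib power2_eq_square field_simps)
  \<comment> \<open>each of the five terms carries a factor of order \<open>\<beta>\<close>: \<open>r2\<close>, \<open>r1\<close>, \<open>1 / n\<close>, or a
    difference between a power of the characteristic function and its Gaussian limit\<close>
  have decomp: "(of_nat n * char2 t * ?\<phi> ^ (n - 1) + of_nat n * of_nat (n - 1) * (char1 t)\<^sup>2 * ?\<phi> ^ (n - 2))
      - (1 - B2 - t\<^sup>2) * exp (- (t\<^sup>2 / 2))
    = r2 * ?\<phi> ^ (n - 1) + complex_of_real (1 - B2) * (?\<phi> ^ (n - 1) - ?e)
      + ?c * (r1 * (r1 + 2 * \<i> * t)) * ?\<phi> ^ (n - 2)
      + (- (?c * of_real (t\<^sup>2))) * (?\<phi> ^ (n - 2) - ?e) + complex_of_real (t\<^sup>2 * (1 / real n)) * ?e"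
  proof -
    have alg: "((r2 + d) * p + c * (r1 + x)\<^sup>2 * q) - (d - T) * e
      = r2 * p + d * (p - e) + c * (r1 * (r1 + 2 * x)) * q + (- (c * T)) * (q - e) + (T * m) * e"
      if "T = - x\<^sup>2" "c = 1 - m" for r2 d p c r1 x q T m e :: complex
      unfolding that by (simp add: algebra_simps power2_eq_square)
    have a: "of_nat n * char2 t = r2 + complex_of_real (1 - B2)" "of_nat n * char1 t = r1 + \<i> * t"
      by (simp_all add: r2_def r1_def)
    have T: "complex_of_real ((1 - B2 - t\<^sup>2) * exp (- (t\<^sup>2 / 2)))
        = (complex_of_real (1 - B2) - complex_of_real (t\<^sup>2)) * ?e" by simp
    have b: "complex_of_real (t\<^sup>2) = - (\<i> * t)\<^sup>2" by (simp add: power_mult_distrib)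
    have c: "?c = 1 - complex_of_real (1 / real n)" by simp
    show ?thesis
      unfolding sq a T of_real_mult[of "t\<^sup>2" "1 / real n"] mult.assoc[of 2] by (rule alg[OF b c])
  qed
  have T1: "cmod (r2 * ?\<phi> ^ (n - 1)) \<le> t * ?b * ?E"
    unfolding norm_mult norm_power using t b0 by (intro mult_mono r2 \<phi>k) auto
  have T2: "cmod (complex_of_real (1 - B2) * (?\<phi> ^ (n - 1) - ?e)) \<le> 1 * (?E * (?b * (2 * t\<^sup>2 + t ^ 3 + t ^ 4)))"
    unfolding norm_mult using B2_nonneg B2_le_1 by (intro mult_mono D) (auto simp del: of_real_diff)
  have T3: "cmod (?c * (r1 * (r1 + 2 * \<i> * t)) * ?\<phi> ^ (n - 2)) \<le> 1 * ((t * (?b * (2 + t / 2))) * (3 * t)) * ?E"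
  proof -
    have "cmod (r1 + 2 * \<i> * t) \<le> cmod r1 + cmod (2 * \<i> * t)" by (rule norm_triangle_ineq)
    also have "cmod (2 * \<i> * t) = 2 * t" using t by (simp add: norm_mult)
    finally have "cmod (r1 + 2 * \<i> * t) \<le> 3 * t" using r1(2) by linarith
    then show ?thesis
      unfolding norm_mult norm_power using t b0 by (intro mult_mono c r1 \<phi>k) (auto simp del: of_real_diff)
  qed
  have T4: "cmod ((- (?c * of_real (t\<^sup>2))) * (?\<phi> ^ (n - 2) - ?e)) \<le> (1 * t\<^sup>2) * (?E * (?b * (2 * t\<^sup>2 + t ^ 3 + t ^ 4)))"
    unfolding norm_mult norm_minus_cancel by (intro mult_mono c D) (auto simp del: of_real_diff of_real_power)
  have T5: "cmod (complex_of_real (t\<^sup>2 * (1 / real n)) * ?e) \<le> (t\<^sup>2 * ?b) * ?E"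
  proof -
    have "t\<^sup>2 * (1 / real n) \<le> t\<^sup>2 * ?b" using nb b0 by (intro mult_left_mono) auto
    then show ?thesis
      unfolding norm_mult norm_of_real using b0 eE by (intro mult_mono) (auto simp: abs_of_nonneg)
  qed
  have "cmod (r2 * ?\<phi> ^ (n - 1) + complex_of_real (1 - B2) * (?\<phi> ^ (n - 1) - ?e)
      + ?c * (r1 * (r1 + 2 * \<i> * t)) * ?\<phi> ^ (n - 2)
      + (- (?c * of_real (t\<^sup>2))) * (?\<phi> ^ (n - 2) - ?e) + complex_of_real (t\<^sup>2 * (1 / real n)) * ?e)
    \<le> t * ?b * ?E + 1 * (?E * (?b * (2 * t\<^sup>2 + t ^ 3 + t ^ 4))) + 1 * ((t * (?b * (2 + t / 2))) * (3 * t)) * ?E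
      + (1 * t\<^sup>2) * (?E * (?b * (2 * t\<^sup>2 + t ^ 3 + t ^ 4))) + (t\<^sup>2 * ?b) * ?E"
    by (intro order_trans[OF norm_triangle_ineq] add_mono T1 T2 T3 T4 T5)
  also have "\<dots> = t * (?b * ((1 + 9 * t + 5 / 2 * t\<^sup>2 + 3 * t ^ 3 + t ^ 4 + t ^ 5) * ?E))"
  proof -
    have "t * c * E + 1 * (E * (c * (2 * t\<^sup>2 + t ^ 3 + t ^ 4))) + 1 * ((t * (c * (2 + t / 2))) * (3 * t)) * E
      + (1 * t\<^sup>2) * (E * (c * (2 * t\<^sup>2 + t ^ 3 + t ^ 4))) + (t\<^sup>2 * c) * E
      = t * (c * ((1 + 9 * t + 5 / 2 * t\<^sup>2 + 3 * t ^ 3 + t ^ 4 + t ^ 5) * E))" for c E :: real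
      by (simp add: eval_nat_numeral algebra_simps)
    then show ?thesis .
  qed
  finally show ?thesis unfolding decomp .
qed

end

section \<open>From square-weighted measures back to distribution functions\<close>

lemma real_distribution_square_density:
  assumes "real_distribution L" and i: "integrable L (\<lambda>x. x\<^sup>2)" and "(LINT x|L. x\<^sup>2) = 1"
  shows "real_distribution (density L (\<lambda>x. ennreal (x\<^sup>2)))"
proof -
  interpret L: real_distribution L by fact
  have "emeasure (density L (\<lambda>x. ennreal (x\<^sup>2))) (space L) = (\<integral>\<^sup>+x. ennreal (x\<^sup>2) \<partial>L)"
    by (subst emeasure_density) (auto intro!: nn_integral_cong)
  also have "\<dots> = 1"
    by (subst nn_integral_eq_integral[OF i]) (simp_all add: assms(3))
  finally have "prob_space (density L (\<lambda>x. ennreal (x\<^sup>2)))"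
    by (intro prob_spaceI) simp
  then show ?thesis
    by (simp add: real_distribution_def real_distribution_axioms_def)
qed

lemma integral_square_density:
  fixes f :: "real \<Rightarrow> real"
  assumes "real_distribution L" "f \<in> borel_measurable borel"
  shows "(LINT x|density L (\<lambda>x. ennreal (x\<^sup>2)). f x) = (LINT x|L. x\<^sup>2 * f x)"
proof -
  interpret L: real_distribution L by fact
  show ?thesis using assms(2) by (subst integral_density) auto
qed

lemma integral_two_over_cube:
  assumes "r > 0"
  shows "integrable lborel (\<lambda>s. indicat_real {r..} s * (2 / s ^ 3))"
    and "(LINT s|lborel. indicat_real {r..} s * (2 / s ^ 3)) = 1 / r\<^sup>2"
proof -
  have lim: "((\<lambda>s::real. - 1 / s\<^sup>2) \<longlongrightarrow> 0) at_top"
    by real_asymp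
  have nn: "(\<integral>\<^sup>+s. ennreal (2 / s ^ 3) * indicator {r..} s \<partial>lborel) = ennreal (0 - (- 1 / r\<^sup>2))"
  proof (rule nn_integral_FTC_atLeast[OF _ _ _ lim])
    fix s assume "r \<le> s"
    then have "s > 0" using assms by simp
    then show "((\<lambda>s. - 1 / s\<^sup>2) has_real_derivative 2 / s ^ 3) (at s)"
      by (auto intro!: derivative_eq_intros simp: power2_eq_square power3_eq_cube)
    show "0 \<le> 2 / s ^ 3" using \<open>s > 0\<close> by simp
  qed simp
  have eq: "(\<integral>\<^sup>+s. ennreal (indicat_real {r..} s * (2 / s ^ 3)) \<partial>lborel) = ennreal (1 / r\<^sup>2)"
  proof -
    have "ennreal (indicat_real {r..} s * (2 / s ^ 3)) = ennreal (2 / s ^ 3) * indicator {r..} s" for s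
      by (auto split: split_indicator)
    then show ?thesis using nn by simp
  qed
  have nneg: "0 \<le> indicat_real {r..} s * (2 / s ^ 3)" for s
    using assms by (auto split: split_indicator)
  show "integrable lborel (\<lambda>s. indicat_real {r..} s * (2 / s ^ 3))"
    by (rule integrableI_nn_integral_finite[OF _ _ eq]) (use nneg in auto)
  show "(LINT s|lborel. indicat_real {r..} s * (2 / s ^ 3)) = 1 / r\<^sup>2"
  proof -
    have "(LINT s|lborel. indicat_real {r..} s * (2 / s ^ 3))
        = enn2real (\<integral>\<^sup>+s. ennreal (indicat_real {r..} s * (2 / s ^ 3)) \<partial>lborel)"
      by (rule integral_eq_nn_integral) (use nneg in auto)
    also have "\<dots> = 1 / r\<^sup>2" unfolding eq by simp
    finally show ?thesis .
  qed
qed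

text \<open>For \<open>w \<in> B\<close> the integral of \<open>2 / s\<^sup>3\<close> over \<open>s \<ge> \<bar>w\<bar>\<close> is \<open>1 / w\<^sup>2\<close>, so by Fubini's theorem the
\<open>L\<close>-measure of \<open>B\<close> is an average of measures with density \<open>x\<^sup>2\<close>. The half-open interval \<open>{- s<..s}\<close> is chosen because its
intersections with half-lines are measured by differences of distribution functions.\<close>

lemma measure_eq_square_density_average:
  assumes L: "real_distribution L" and i: "integrable L (\<lambda>x. x\<^sup>2)"
    and B[measurable]: "B \<in> sets borel" and r: "r > 0" and Br: "\<And>w. w \<in> B \<Longrightarrow> r \<le> \<bar>w\<bar>"
  defines "c \<equiv> \<lambda>s. measure (density L (\<lambda>x. ennreal (x\<^sup>2))) (B \<inter> {- s<..s})"
  shows "integrable lborel (\<lambda>s. indicat_real {r..} s * (2 / s ^ 3) * c s)"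
    and "measure L B = (LINT s|lborel. indicat_real {r..} s * (2 / s ^ 3) * c s)"
proof -
  interpret L: real_distribution L by fact
  interpret P: pair_sigma_finite L lborel ..
  define f where "f w s = (w\<^sup>2 * indicat_real B w) *
    (indicat_real {r..} s * (2 / s ^ 3) * indicat_real {p. - snd p < fst p \<and> fst p \<le> snd p} (w, s))" for w s
  have f0: "f w s \<ge> 0" for w s
    using r by (auto simp: f_def split: split_indicator)
  have inner: "integrable lborel (\<lambda>s. f w s)" "(LINT s|lborel. f w s) = indicat_real B w" for w
  proof -
    have "integrable lborel (\<lambda>s. f w s) \<and> (LINT s|lborel. f w s) = indicat_real B w"
    proof (cases "w \<in> B")
      case True
      then have w: "\<bar>w\<bar> > 0" "r \<le> \<bar>w\<bar>" using Br[of w] r by auto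
      \<comment> \<open>for negative \<open>w\<close> the two sides differ at the single point \<open>s = \<bar>w\<bar>\<close>\<close>
      have ae: "AE s in lborel. f w s = w\<^sup>2 * (indicat_real {\<bar>w\<bar>..} s * (2 / s ^ 3))"
        using AE_lborel_singleton[of "\<bar>w\<bar>"]
      proof eventually_elim
        case (elim s)
        then show ?case using True w by (auto simp: f_def split: split_indicator)
      qed
      have [measurable]: "(\<lambda>s. f w s) \<in> borel_measurable lborel" unfolding f_def by measurable
      have "integrable lborel (\<lambda>s. w\<^sup>2 * (indicat_real {\<bar>w\<bar>..} s * (2 / s ^ 3)))"
        by (intro integrable_mult_right integral_two_over_cube(1) w)
      then have "integrable lborel (\<lambda>s. f w s)"
        by (subst integrable_cong_AE[OF _ _ ae]) simp_all
      moreover have "(LINT s|lborel. f w s) = w\<^sup>2 * (1 / \<bar>w\<bar>\<^sup>2)"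
        unfolding integral_two_over_cube(2)[OF w(1), symmetric]
        by (subst integral_cong_AE[OF _ _ ae]) (simp_all only: integral_mult_right_zero, measurable)
      ultimately show ?thesis using True w by simp
    qed (simp add: f_def)
    then show "integrable lborel (\<lambda>s. f w s)" "(LINT s|lborel. f w s) = indicat_real B w" by auto
  qed
  have fi: "integrable (L \<Otimes>\<^sub>M lborel) (case_prod f)"
  proof (rule P.Fubini_integrable)
    show "case_prod f \<in> borel_measurable (L \<Otimes>\<^sub>M lborel)"
      unfolding f_def[abs_def] by measurable
    show "AE w in L. integrable lborel (\<lambda>s. case_prod f (w, s))" using inner by simp
    have "(LINT s|lborel. norm (case_prod f (w, s))) = indicat_real B w" for w
      using inner(2)[of w] f0 by simp
    then show "integrable L (\<lambda>w. LINT s|lborel. norm (case_prod f (w, s)))"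
      by (simp only:) (auto intro!: L.integrable_const_bound[of _ 1])
  qed
  have outer: "(LINT w|L. f w s) = indicat_real {r..} s * (2 / s ^ 3) * c s" for s
  proof -
    have "c s = (LINT w|density L (\<lambda>x. ennreal (x\<^sup>2)). indicat_real (B \<inter> {- s<..s}) w)"
      by (simp add: c_def)
    also have "\<dots> = (LINT w|L. w\<^sup>2 * indicat_real (B \<inter> {- s<..s}) w)"
      by (rule integral_square_density[OF L]) simp
    finally have c: "c s = (LINT w|L. w\<^sup>2 * indicat_real (B \<inter> {- s<..s}) w)" .
    have "f w s = (indicat_real {r..} s * (2 / s ^ 3)) * (w\<^sup>2 * indicat_real (B \<inter> {- s<..s}) w)" for w
      by (auto simp: f_def split: split_indicator)
    then show ?thesis by (simp add: c)
  qed
  show "integrable lborel (\<lambda>s. indicat_real {r..} s * (2 / s ^ 3) * c s)"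
    using P.integrable_snd[OF fi] by (simp only: outer)
  have "measure L B = (LINT w|L. LINT s|lborel. f w s)" by (simp add: inner(2))
  also have "\<dots> = (LINT s|lborel. LINT w|L. f w s)" by (rule P.Fubini_integral[OF fi, symmetric])
  finally show "measure L B = (LINT s|lborel. indicat_real {r..} s * (2 / s ^ 3) * c s)"
    by (simp only: outer)
qed

text \<open>For \<open>z > 0\<close> the event is \<open>{z<..}\<close>, for \<open>z < 0\<close> it is \<open>{..z}\<close>; in both cases its
truncations are half-open intervals.\<close>

lemma cdf_difference_from_square_density:
  assumes L: "real_distribution L" and iL: "integrable L (\<lambda>x. x\<^sup>2)" "(LINT x|L. x\<^sup>2) = 1"
    and N: "real_distribution N" and iN: "integrable N (\<lambda>x. x\<^sup>2)" "(LINT x|N. x\<^sup>2) = 1"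
    and \<eta>: "\<And>x. \<bar>cdf (density L (\<lambda>x. ennreal (x\<^sup>2))) x - cdf (density N (\<lambda>x. ennreal (x\<^sup>2))) x\<bar> \<le> \<eta>"
    and z: "z \<noteq> 0"
  shows "\<bar>cdf L z - cdf N z\<bar> \<le> 2 * \<eta> / z\<^sup>2"
proof -
  interpret L: real_distribution L by fact
  interpret N: real_distribution N by fact
  let ?L = "density L (\<lambda>x. ennreal (x\<^sup>2))" and ?N = "density N (\<lambda>x. ennreal (x\<^sup>2))"
  interpret L2: real_distribution ?L by (rule real_distribution_square_density[OF L iL])
  interpret N2: real_distribution ?N by (rule real_distribution_square_density[OF N iN])
  define B where "B = (if z > 0 then {z<..} else {..z})"
  have B: "B \<in> sets borel" "\<And>w. w \<in> B \<Longrightarrow> \<bar>z\<bar> \<le> \<bar>w\<bar>"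
    by (auto simp: B_def split: if_splits)
  have r: "\<bar>z\<bar> > 0" using z by simp
  have LB: "\<bar>cdf L z - cdf N z\<bar> = \<bar>measure L B - measure N B\<bar>"
  proof (cases "z > 0")
    case True
    have "measure L {z<..} = 1 - cdf L z" "measure N {z<..} = 1 - cdf N z"
      using L.prob_compl[of "{..z}"] N.prob_compl[of "{..z}"]
      by (simp_all add: cdf_def Compl_eq_Diff_UNIV[symmetric])
    then show ?thesis using True by (simp add: B_def)
  qed (simp add: B_def cdf_def)
  let ?cL = "\<lambda>s. measure ?L (B \<inter> {- s<..s})" and ?cN = "\<lambda>s. measure ?N (B \<inter> {- s<..s})"
  have c: "\<bar>?cL s - ?cN s\<bar> \<le> 2 * \<eta>" if s: "s \<ge> \<bar>z\<bar>" for s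
  proof -
    have "\<exists>x y. x \<le> y \<and> B \<inter> {- s<..s} = {x<..y}"
    proof (cases "z > 0")
      case True
      with s show ?thesis by (intro exI[of _ z] exI[of _ s]) (auto simp: B_def)
    next
      case False
      with s show ?thesis by (intro exI[of _ "- s"] exI[of _ z]) (auto simp: B_def)
    qed
    then obtain x y where xy: "x \<le> y" "B \<inter> {- s<..s} = {x<..y}" by blast
    have "?cL s = cdf ?L y - cdf ?L x" "?cN s = cdf ?N y - cdf ?N x"
      unfolding xy(2) using xy(1) L2.cdf_diff_eq[of x y] N2.cdf_diff_eq[of x y]
      by (cases "x = y"; simp)+
    then show ?thesis using \<eta>[of x] \<eta>[of y] by linarith
  qed
  let ?k = "\<lambda>s. indicat_real {\<bar>z\<bar>..} s * (2 / s ^ 3)"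
  note mL = measure_eq_square_density_average[OF L iL(1) B(1) r B(2)]
  note mN = measure_eq_square_density_average[OF N iN(1) B(1) r B(2)]
  have "measure L B - measure N B = (LINT s|lborel. ?k s * ?cL s - ?k s * ?cN s)"
    using Bochner_Integration.integral_diff[OF mL(1) mN(1)] mL(2) mN(2) by (simp only:)
  moreover have "\<bar>LINT s|lborel. ?k s * ?cL s - ?k s * ?cN s\<bar> \<le> (LINT s|lborel. \<bar>?k s * ?cL s - ?k s * ?cN s\<bar>)"
    by (rule integral_abs_bound)
  moreover have "(LINT s|lborel. \<bar>?k s * ?cL s - ?k s * ?cN s\<bar>) \<le> (LINT s|lborel. ?k s * (2 * \<eta>))"
  proof (rule integral_mono)
    show "integrable lborel (\<lambda>s. \<bar>?k s * ?cL s - ?k s * ?cN s\<bar>)"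
      by (intro integrable_abs Bochner_Integration.integrable_diff mL(1) mN(1))
    show "integrable lborel (\<lambda>s. ?k s * (2 * \<eta>))"
      by (intro integrable_mult_left integral_two_over_cube(1) r)
    fix s
    show "\<bar>?k s * ?cL s - ?k s * ?cN s\<bar> \<le> ?k s * (2 * \<eta>)"
    proof (cases "s \<ge> \<bar>z\<bar>")
      case True
      then have k: "?k s \<ge> 0" using r by simp
      have "\<bar>?k s * ?cL s - ?k s * ?cN s\<bar> = ?k s * \<bar>?cL s - ?cN s\<bar>"
        using abs_mult[of "?k s" "?cL s - ?cN s"] abs_of_nonneg[OF k] by (simp only: right_diff_distrib)
      also have "\<dots> \<le> ?k s * (2 * \<eta>)" by (intro mult_left_mono c True k)
      finally show ?thesis .
    qed simp
  qed
  moreover have "(LINT s|lborel. ?k s * (2 * \<eta>)) = 2 * \<eta> / z\<^sup>2"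
  proof -
    have "(LINT s|lborel. ?k s * (2 * \<eta>)) = (LINT s|lborel. ?k s) * (2 * \<eta>)"
      by (rule integral_mult_left_zero)
    then show ?thesis unfolding integral_two_over_cube(2)[OF r] by simp
  qed
  ultimately show ?thesis unfolding LB by linarith
qed

section \<open>Cantelli's inequality\<close>

text \<open>Markov's inequality for \<open>(1 + z w)\<^sup>2\<close>, whose expectation is \<open>1 + z\<^sup>2\<close>; on the event in question
\<open>z w \<ge> z\<^sup>2\<close>.\<close>

lemma cantelli_cdf:
  assumes "real_distribution L" and i: "integrable L (\<lambda>x. x)" "integrable L (\<lambda>x. x\<^sup>2)"
    and m: "(LINT x|L. x) = 0" "(LINT x|L. x\<^sup>2) = 1"
  shows "z \<ge> 0 \<Longrightarrow> 1 - cdf L z \<le> 1 / (1 + z\<^sup>2)" "z \<le> 0 \<Longrightarrow> cdf L z \<le> 1 / (1 + z\<^sup>2)"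
proof -
  interpret L: real_distribution L by fact
  have main: "measure L B \<le> 1 / (1 + z\<^sup>2)" if [measurable]: "B \<in> sets borel" and B: "\<And>w. w \<in> B \<Longrightarrow> z * w \<ge> z\<^sup>2" for B
  proof -
    have p: "1 + z\<^sup>2 > 0" by (simp add: add_pos_nonneg)
    have "(LINT w|L. (1 + z\<^sup>2)\<^sup>2 * indicat_real B w) \<le> (LINT w|L. 1 + 2 * z * w + z\<^sup>2 * w\<^sup>2)"
    proof (rule integral_mono)
      show "integrable L (\<lambda>w. (1 + z\<^sup>2)\<^sup>2 * indicat_real B w)"
        by (intro integrable_mult_right L.integrable_const_bound[of _ 1]) auto
      show "integrable L (\<lambda>w. 1 + 2 * z * w + z\<^sup>2 * w\<^sup>2)" using i by simp
      fix w
      have "1 + 2 * z * w + z\<^sup>2 * w\<^sup>2 = (1 + z * w)\<^sup>2" by (simp add: power2_eq_square algebra_simps)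
      moreover have "(1 + z\<^sup>2)\<^sup>2 \<le> (1 + z * w)\<^sup>2" if "w \<in> B"
        using B[OF that] p by (intro power_mono) auto
      ultimately show "(1 + z\<^sup>2)\<^sup>2 * indicat_real B w \<le> 1 + 2 * z * w + z\<^sup>2 * w\<^sup>2"
        by (auto split: split_indicator)
    qed
    then have "(1 + z\<^sup>2)\<^sup>2 * measure L B \<le> 1 + z\<^sup>2"
      using i m L.prob_space by (simp del: L.space_eq_univ)
    then have "(1 + z\<^sup>2) * ((1 + z\<^sup>2) * measure L B) \<le> (1 + z\<^sup>2) * 1"
      by (simp only: power2_eq_square[of "1 + z\<^sup>2"] mult.assoc mult_1_right)
    then have "(1 + z\<^sup>2) * measure L B \<le> 1"
      using p by (simp only: mult_le_cancel_left_pos)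
    then show ?thesis using p by (simp add: pos_le_divide_eq mult.commute)
  qed
  show "1 - cdf L z \<le> 1 / (1 + z\<^sup>2)" if "z \<ge> 0"
  proof -
    have "measure L {z<..} = 1 - cdf L z"
      using L.prob_compl[of "{..z}"] by (simp add: cdf_def Compl_eq_Diff_UNIV[symmetric])
    moreover have "measure L {z<..} \<le> 1 / (1 + z\<^sup>2)"
      using that by (intro main) (auto simp: power2_eq_square intro!: mult_left_mono)
    ultimately show ?thesis by simp
  qed
  show "cdf L z \<le> 1 / (1 + z\<^sup>2)" if "z \<le> 0"
    unfolding cdf_def using that by (intro main) (auto simp: power2_eq_square intro!: mult_left_mono_neg)
qed

lemma cdf_difference_trivial:
  assumes L: "real_distribution L" "integrable L (\<lambda>x. x)" "integrable L (\<lambda>x. x\<^sup>2)" "(LINT x|L. x) = 0" "(LINT x|L. x\<^sup>2) = 1"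
    and N: "real_distribution N" "integrable N (\<lambda>x. x)" "integrable N (\<lambda>x. x\<^sup>2)" "(LINT x|N. x) = 0" "(LINT x|N. x\<^sup>2) = 1"
  shows "\<bar>cdf L z - cdf N z\<bar> \<le> 2 / (1 + \<bar>z\<bar>)\<^sup>2"
proof -
  interpret L: real_distribution L by fact
  interpret N: real_distribution N by fact
  have "0 \<le> cdf L z" "cdf L z \<le> 1" "0 \<le> cdf N z" "cdf N z \<le> 1"
    by (auto simp: L.cdf_nonneg N.cdf_nonneg L.cdf_bounded_prob N.cdf_bounded_prob)
  then have "\<bar>cdf L z - cdf N z\<bar> \<le> 1 / (1 + z\<^sup>2)"
    using cantelli_cdf[OF L, of z] cantelli_cdf[OF N, of z] by (cases "z \<ge> 0") linarith+
  also have "\<dots> \<le> 2 / (1 + \<bar>z\<bar>)\<^sup>2"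
  proof -
    have "0 \<le> (1 - \<bar>z\<bar>)\<^sup>2" by simp
    then have "(1 + \<bar>z\<bar>)\<^sup>2 \<le> 2 * (1 + \<bar>z\<bar>\<^sup>2)" by (simp add: power2_eq_square algebra_simps)
    moreover have "(1 + \<bar>z\<bar>)\<^sup>2 > 0" "1 + z\<^sup>2 > 0" by (auto simp: add_pos_nonneg zero_less_power)
    ultimately show ?thesis by (simp add: field_simps)
  qed
  finally show ?thesis .
qed

section \<open>The standard normal distribution\<close>

text \<open>If \<open>\<pi> / 6\<close> were at most \<open>31 / 60\<close>, the Taylor polynomial of the sine would give
\<open>sin (\<pi> / 6) < 1 / 2\<close>. In the numerical estimate for the uniform constant
\<open>37 / 9\<close> below, the bound \<open>\<pi> > 3\<close> would not suffice.\<close>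

lemma pi_lower_bound: "pi > 31 / 10"
proof (rule ccontr)
  assume "\<not> ?thesis"
  then have "pi / 6 \<le> 31 / 60" by simp
  moreover have "31 / 60 \<le> pi / 2" using pi_ge_two by simp
  ultimately have "sin (pi / 6) \<le> sin (31 / 60)"
    using pi_gt_zero by (intro sin_monotone_2pi_le) auto
  moreover have "sin (31 / 60 :: real) < 1 / 2"
  proof -
    have "(\<Sum>m<5. sin_coeff m * (31 / 60) ^ m) = (639809 / 1296000 :: real)"
      by (simp add: sin_coeff_Suc cos_coeff_Suc eval_nat_numeral)
    moreover have "inverse (fact 5) * \<bar>31 / 60\<bar> ^ 5 = (28629151 / 93312000000 :: real)"
      by (simp add: fact_numeral power_divide)
    ultimately show ?thesis
      using Maclaurin_sin_bound[of "31 / 60" 5] by linarith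
  qed
  ultimately show False by (simp add: sin_30)
qed

lemma inverse_sqrt_2pi_le: "1 / sqrt (2 * pi) \<le> 2 / 5 + 1 / 500"
proof -
  have "(1000 / 402)\<^sup>2 \<le> 2 * pi" using pi_lower_bound by (simp add: power2_eq_square)
  then have "1000 / 402 \<le> sqrt (2 * pi)" by (rule real_le_rsqrt)
  then show ?thesis by (simp add: field_simps)
qed

lemma cdf_density_lipschitz:
  assumes D: "real_distribution (density lborel (\<lambda>x. ennreal (f x)))"
    and [measurable]: "f \<in> borel_measurable borel"
    and f: "\<And>x. f x \<le> m" and m: "m \<ge> 0" and le: "x \<le> y"
  shows "cdf (density lborel (\<lambda>x. ennreal (f x))) y - cdf (density lborel (\<lambda>x. ennreal (f x))) x \<le> m * (y - x)"
proof -
  interpret D: real_distribution "density lborel (\<lambda>x. ennreal (f x))" by fact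
  show ?thesis
  proof (cases "x = y")
    case False
    then have "x < y" using le by simp
    then have "cdf (density lborel (\<lambda>x. ennreal (f x))) y - cdf (density lborel (\<lambda>x. ennreal (f x))) x
        = measure (density lborel (\<lambda>x. ennreal (f x))) {x<..y}"
      by (rule D.cdf_diff_eq)
    moreover have "emeasure (density lborel (\<lambda>x. ennreal (f x))) {x<..y} \<le> ennreal (m * (y - x))"
    proof -
      have "emeasure (density lborel (\<lambda>x. ennreal (f x))) {x<..y} = (\<integral>\<^sup>+w. ennreal (f w) * indicator {x<..y} w \<partial>lborel)"
        by (rule emeasure_density) auto
      also have "\<dots> \<le> (\<integral>\<^sup>+w. ennreal m * indicator {x<..y} w \<partial>lborel)"
        by (intro nn_integral_mono mult_right_mono ennreal_leI f) simp
      also have "\<dots> = ennreal (m * (y - x))"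
        using m le by (simp add: nn_integral_cmult_indicator ennreal_mult)
      finally show ?thesis .
    qed
    ultimately show ?thesis
      using m le by (simp add: D.emeasure_eq_measure)
  qed simp
qed

lemma std_normal_moments:
  "integrable std_normal_distribution (\<lambda>x. x)" "integrable std_normal_distribution (\<lambda>x. x\<^sup>2)"
  "(LINT x|std_normal_distribution. x) = 0" "(LINT x|std_normal_distribution. x\<^sup>2) = 1"
  using integrable_std_normal_distribution_moment[of 1] integrable_std_normal_distribution_moment[of 2]
    integral_std_normal_distribution_moment_odd[of 1] std_normal_distribution_even_moments(1)[of 1]
  by simp_all

lemma std_normal_density_le: "std_normal_density x \<le> 1 / sqrt (2 * pi)"
  by (simp add: std_normal_density_def divide_right_mono)

lemma square_std_normal_density_le: "x\<^sup>2 * std_normal_density x \<le> 1 / sqrt (2 * pi)"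
proof -
  have "x\<^sup>2 * exp (- (x\<^sup>2 / 2)) \<le> 1"
  proof -
    have "1 + x\<^sup>2 / 2 + (x\<^sup>2 / 2)\<^sup>2 / 2 \<le> exp (x\<^sup>2 / 2)" by (rule exp_lower_Taylor_quadratic) simp
    moreover have "x\<^sup>2 \<le> 1 + x\<^sup>2 / 2 + (x\<^sup>2 / 2)\<^sup>2 / 2"
      using zero_le_power2[of "x\<^sup>2 / 2 - 1"] by (simp add: power2_eq_square algebra_simps)
    ultimately have "x\<^sup>2 \<le> exp (x\<^sup>2 / 2)" by linarith
    then have "x\<^sup>2 * exp (- (x\<^sup>2 / 2)) \<le> exp (x\<^sup>2 / 2) * exp (- (x\<^sup>2 / 2))"
      by (rule mult_right_mono) simp
    then show ?thesis by (simp add: exp_minus_inverse)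
  qed
  then show ?thesis by (simp add: std_normal_density_def divide_right_mono)
qed

lemma square_density_std_normal:
  "density std_normal_distribution (\<lambda>x. ennreal (x\<^sup>2)) = density lborel (\<lambda>x. ennreal (x\<^sup>2 * std_normal_density x))"
  by (subst density_density_eq) (auto simp: ennreal_mult mult.commute)

text \<open>Integrating the derivatives of \<open>p x e\<^sup>i\<^sup>t\<^sup>x\<close> and \<open>x p x e\<^sup>i\<^sup>t\<^sup>x\<close>, with \<open>p\<close> the normal density, over the line
gives \<open>I\<^sub>1 = i t I\<^sub>0\<close> and \<open>I\<^sub>2 = I\<^sub>0 + i t I\<^sub>1\<close> for the transforms of \<open>x\<^sup>k p x\<close>.\<close>

lemma std_normal_square_char:
  "(CLINT x|std_normal_distribution. complex_of_real (x\<^sup>2) * iexp (t * x)) = (1 - t\<^sup>2) * exp (- (t\<^sup>2 / 2))"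
proof -
  let ?p = std_normal_density
  define I where "I k = (CLINT x|lborel. complex_of_real (?p x * x ^ k) * iexp (t * x))" for k
  have int: "integrable lborel (\<lambda>x. complex_of_real (?p x * x ^ k) * iexp (t * x))" for k
    using integrable_std_normal_moment[of k]
    by (rule Bochner_Integration.integrable_bound) (auto simp: norm_mult simp del: of_real_mult)
  have dens: "(CLINT x|std_normal_distribution. complex_of_real (x ^ k) * iexp (t * x)) = I k" for k
    unfolding I_def by (subst integral_density) (auto simp: scaleR_conv_of_real mult.assoc)
  have dp: "(?p has_real_derivative - x * ?p x) (at x)" for x
  proof -
    have "((\<lambda>x. 1 / sqrt (2 * pi) * exp (- x\<^sup>2 / 2)) has_real_derivative
        1 / sqrt (2 * pi) * (exp (- x\<^sup>2 / 2) * (- x))) (at x)"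
      by (rule DERIV_cmult) (auto intro!: derivative_eq_intros)
    then show ?thesis
      unfolding std_normal_density_def by (simp add: mult.commute)
  qed
  have zero: "(CLINT x|lborel. f x) = 0"
    if F: "\<And>x. ((\<lambda>x. complex_of_real (?p x * x ^ k) * iexp (t * x)) has_vector_derivative f x) (at x)"
    and f: "integrable lborel f" "\<And>x. isCont f x" and k: "k = 0 \<or> k = 1" for f k
  proof -
    have lim: "((\<lambda>x. ?p x * x ^ k) \<longlongrightarrow> 0) at_top" "((\<lambda>x. ?p x * x ^ k) \<longlongrightarrow> 0) at_bot"
      using k unfolding std_normal_density_def by (elim disjE; simp; real_asymp)+
    have lim': "((\<lambda>x. complex_of_real (?p x * x ^ k) * iexp (t * x)) \<longlongrightarrow> 0) F"
      if "((\<lambda>x. ?p x * x ^ k) \<longlongrightarrow> 0) F" for F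
    proof (rule tendsto_norm_zero_cancel)
      have "cmod (complex_of_real g * iexp y) = \<bar>g\<bar>" for g y
        by (simp only: norm_mult norm_of_real norm_exp_i_times mult_1_right)
      then show "((\<lambda>x. cmod (complex_of_real (?p x * x ^ k) * iexp (t * x))) \<longlongrightarrow> 0) F"
        using tendsto_rabs_zero[OF that] by (simp only:)
    qed
    have "(CLBINT x=-\<infinity>..\<infinity>. f x) = 0 - 0"
      by (rule interval_integral_FTC_integrable[OF _ F])
        (use f lim'[OF lim(1)] lim'[OF lim(2)] in \<open>simp_all add: ereal_tendsto_simps set_integrable_def einterval_def del: of_real_mult\<close>)
    then show ?thesis by (simp add: interval_lebesgue_integral_def set_lebesgue_integral_def einterval_def)
  qed
  have deriv: "((\<lambda>x. complex_of_real (g x) * iexp (t * x)) has_vector_derivative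
      complex_of_real g' * iexp (t * x) + \<i> * t * (complex_of_real (g x) * iexp (t * x))) (at x)"
    if "(g has_real_derivative g') (at x)" for g g' x
    using that
    by (auto intro!: derivative_eq_intros simp: Re_exp Im_exp has_vector_derivative_complex_iff algebra_simps)
  have "(CLINT x|lborel. \<i> * t * (complex_of_real (?p x * x ^ 0) * iexp (t * x)) - complex_of_real (?p x * x ^ 1) * iexp (t * x)) = 0"
  proof (rule zero[of 0])
    fix x
    show "((\<lambda>x. complex_of_real (?p x * x ^ 0) * iexp (t * x)) has_vector_derivative
      \<i> * t * (complex_of_real (?p x * x ^ 0) * iexp (t * x)) - complex_of_real (?p x * x ^ 1) * iexp (t * x)) (at x)"
      using deriv[OF dp[of x]] by (simp add: mult.commute)
    show "isCont (\<lambda>x. \<i> * t * (complex_of_real (?p x * x ^ 0) * iexp (t * x)) - complex_of_real (?p x * x ^ 1) * iexp (t * x)) x"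
      unfolding std_normal_density_def by (intro continuous_intros) auto
  qed (intro Bochner_Integration.integrable_diff integrable_mult_right int, simp)
  moreover have "(CLINT x|lborel. \<i> * t * (complex_of_real (?p x * x ^ 0) * iexp (t * x)) - complex_of_real (?p x * x ^ 1) * iexp (t * x))
      = \<i> * t * I 0 - I 1"
    unfolding I_def integral_mult_right_zero[symmetric]
    by (rule Bochner_Integration.integral_diff[OF integrable_mult_right[OF int] int])
  ultimately have d0: "I 1 = \<i> * t * I 0" by (simp only: right_minus_eq)
  have "(CLINT x|lborel. \<i> * t * (complex_of_real (?p x * x ^ 1) * iexp (t * x)) +
     (complex_of_real (?p x * x ^ 0) * iexp (t * x) - complex_of_real (?p x * x ^ 2) * iexp (t * x))) = 0"
  proof (rule zero[of 1])
    fix x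
    have "((\<lambda>x. ?p x * x) has_real_derivative ?p x - ?p x * x\<^sup>2) (at x)"
      using dp[of x] by (auto intro!: derivative_eq_intros simp: power2_eq_square)
    from deriv[OF this] show "((\<lambda>x. complex_of_real (?p x * x ^ 1) * iexp (t * x)) has_vector_derivative
      \<i> * t * (complex_of_real (?p x * x ^ 1) * iexp (t * x)) +
     (complex_of_real (?p x * x ^ 0) * iexp (t * x) - complex_of_real (?p x * x ^ 2) * iexp (t * x))) (at x)"
      by (simp add: algebra_simps)
    show "isCont (\<lambda>x. \<i> * t * (complex_of_real (?p x * x ^ 1) * iexp (t * x)) +
     (complex_of_real (?p x * x ^ 0) * iexp (t * x) - complex_of_real (?p x * x ^ 2) * iexp (t * x))) x"
      unfolding std_normal_density_def by (intro continuous_intros) auto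
  qed (intro Bochner_Integration.integrable_add Bochner_Integration.integrable_diff integrable_mult_right int, simp)
  moreover have "(CLINT x|lborel. \<i> * t * (complex_of_real (?p x * x ^ 1) * iexp (t * x)) +
     (complex_of_real (?p x * x ^ 0) * iexp (t * x) - complex_of_real (?p x * x ^ 2) * iexp (t * x)))
     = \<i> * t * I 1 + (I 0 - I 2)"
    unfolding I_def integral_mult_right_zero[symmetric]
      Bochner_Integration.integral_diff[OF int int, symmetric]
    by (rule Bochner_Integration.integral_add[OF integrable_mult_right[OF int] Bochner_Integration.integrable_diff[OF int int]])
  ultimately have "\<i> * t * I 1 + (I 0 - I 2) = 0" by (simp only:)
  then have d1: "I 2 = I 0 + \<i> * t * I 1" by (simp add: algebra_simps)
  have "I 0 = char std_normal_distribution t"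
    unfolding char_def dens[symmetric] by simp
  then have I0: "I 0 = exp (- (t\<^sup>2 / 2))" by (simp add: char_std_normal_distribution)
  show ?thesis unfolding dens d1 d0 I0 by (simp add: algebra_simps power2_eq_square)
qed

section \<open>Sums of independent identically distributed summands\<close>

locale iid_summands = prob_space M + P: centered_summand P n B2 B3
  for M :: "'a measure" and P :: "real measure" and n :: nat and B2 B3 :: real +
  fixes X :: "nat \<Rightarrow> 'a \<Rightarrow> real"
  assumes indep: "indep_vars (\<lambda>_. borel) X {1..n}"
    and distr_X: "\<And>i. i \<in> {1..n} \<Longrightarrow> distr M borel (X i) = P"
begin

definition W :: "'a \<Rightarrow> real" where "W \<omega> = (\<Sum>i=1..n. X i \<omega>)"

lemma X_measurable: "i \<in> {1..n} \<Longrightarrow> X i \<in> borel_measurable M"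
  using indep by (auto simp: indep_vars_def)

lemma W_measurable [measurable]: "W \<in> borel_measurable M"
  unfolding W_def[abs_def] by (intro borel_measurable_sum X_measurable)

lemma real_distribution_W: "real_distribution (distr M borel W)"
  by (rule real_distribution_distr) simp

lemma integral_X:
  fixes f :: "real \<Rightarrow> 'b::{banach, second_countable_topology}"
  assumes "i \<in> {1..n}" "f \<in> borel_measurable borel"
  shows "(LINT \<omega>|M. f (X i \<omega>)) = (LINT x|P. f x)"
  unfolding distr_X[OF assms(1), symmetric] using assms X_measurable[OF assms(1)] by (subst integral_distr) auto

lemma integrable_X:
  fixes f :: "real \<Rightarrow> 'b::{banach, second_countable_topology}"
  assumes "i \<in> {1..n}" "integrable P f"
  shows "integrable M (\<lambda>\<omega>. f (X i \<omega>))"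
proof -
  have [measurable]: "f \<in> borel_measurable borel"
    using borel_measurable_integrable[OF assms(2)] by simp
  have "integrable (distr M borel (X i)) f" using assms by (simp add: distr_X)
  then show ?thesis using X_measurable[OF assms(1)] by (subst (asm) integrable_distr_eq) auto
qed

text \<open>Only \<open>J\<close> empty, a singleton or a pair is used: these give the characteristic function of \<open>W\<close> and the
diagonal and off-diagonal terms of the expansion of \<open>W\<^sup>2\<close>.\<close>

lemma integral_prod_times_iexp:
  fixes q :: "real \<Rightarrow> real"
  assumes q: "integrable P q" and J: "J \<subseteq> {1..n}"
  shows "(CLINT \<omega>|M. complex_of_real (\<Prod>j\<in>J. q (X j \<omega>)) * iexp (t * W \<omega>))
    = (CLINT x|P. complex_of_real (q x) * iexp (t * x)) ^ card J * char P t ^ (n - card J)"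
proof -
  define g where "g j x = (if j \<in> J then complex_of_real (q x) else 1) * iexp (t * x)" for j x
  have [measurable]: "q \<in> borel_measurable borel"
    using borel_measurable_integrable[OF q] by simp
  have gm: "g j \<in> borel_measurable borel" for j
    unfolding g_def[abs_def] by (cases "j \<in> J") simp_all
  have gi: "integrable P (g j)" for j
    unfolding g_def using P.integrable_times_iexp[OF q, of t] P.integrable_iexp_mult[of t]
    by (cases "j \<in> J") simp_all
  have ind: "indep_vars (\<lambda>_. borel) (\<lambda>j \<omega>. g j (X j \<omega>)) {1..n}"
    by (rule indep_vars_compose2[OF indep]) (rule gm)
  have fin: "finite J" using J finite_subset by auto
  have prod: "(\<Prod>j\<in>{1..n}. g j (X j \<omega>)) = complex_of_real (\<Prod>j\<in>J. q (X j \<omega>)) * iexp (t * W \<omega>)" for \<omega>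
  proof -
    have "(\<Prod>j\<in>{1..n}. g j (X j \<omega>))
       = (\<Prod>j\<in>{1..n}. if j \<in> J then complex_of_real (q (X j \<omega>)) else 1) * (\<Prod>j\<in>{1..n}. iexp (t * X j \<omega>))"
      unfolding g_def by (rule prod.distrib)
    also have "(\<Prod>j\<in>{1..n}. if j \<in> J then complex_of_real (q (X j \<omega>)) else 1) = (\<Prod>j\<in>J. complex_of_real (q (X j \<omega>)))"
      using J by (intro prod.mono_neutral_cong_right) auto
    also have "(\<Prod>j\<in>{1..n}. iexp (t * X j \<omega>)) = iexp (t * W \<omega>)"
      by (simp add: exp_sum[symmetric] W_def sum_distrib_left)
    finally show ?thesis by simp
  qed
  have "(CLINT \<omega>|M. \<Prod>j\<in>{1..n}. g j (X j \<omega>)) = (\<Prod>j\<in>{1..n}. CLINT \<omega>|M. g j (X j \<omega>))"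
    by (rule indep_vars_lebesgue_integral[OF _ ind]) (auto intro: integrable_X gi)
  also have "\<dots> = (\<Prod>j\<in>{1..n}. if j \<in> J then (CLINT x|P. complex_of_real (q x) * iexp (t * x)) else char P t)"
  proof (rule prod.cong[OF refl])
    fix j assume "j \<in> {1..n}"
    then have "(CLINT \<omega>|M. g j (X j \<omega>)) = (CLINT x|P. g j x)" by (rule integral_X[OF _ gm])
    also have "\<dots> = (if j \<in> J then (CLINT x|P. complex_of_real (q x) * iexp (t * x)) else char P t)"
      unfolding g_def char_def by (cases "j \<in> J") (simp_all only: if_True if_False mult_1_left simp_thms)
    finally show "(CLINT \<omega>|M. g j (X j \<omega>))
      = (if j \<in> J then (CLINT x|P. complex_of_real (q x) * iexp (t * x)) else char P t)" .
  qed
  also have "\<dots> = (CLINT x|P. complex_of_real (q x) * iexp (t * x)) ^ card J * char P t ^ (n - card J)"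
  proof -
    have "{1..n} \<inter> {j. j \<in> J} = J" "{1..n} \<inter> - {j. j \<in> J} = {1..n} - J" using J by auto
    then show ?thesis
      using J fin by (subst prod.If_cases) (simp_all add: card_Diff_subset)
  qed
  finally show ?thesis unfolding prod .
qed

lemma char_W: "(CLINT \<omega>|M. iexp (t * W \<omega>)) = char P t ^ n"
  using integral_prod_times_iexp[OF P.integrable_id, of "{}" t] by simp

lemma integrable_product:
  assumes "i \<in> {1..n}" "j \<in> {1..n}"
  shows "integrable M (\<lambda>\<omega>. X i \<omega> * X j \<omega>)"
proof (rule Bochner_Integration.integrable_bound)
  show "integrable M (\<lambda>\<omega>. (X i \<omega>)\<^sup>2 + (X j \<omega>)\<^sup>2)"
    by (intro Bochner_Integration.integrable_add integrable_X[OF _ P.integrable_square] assms)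
  show "(\<lambda>\<omega>. X i \<omega> * X j \<omega>) \<in> borel_measurable M"
    using X_measurable assms by simp
  have "\<bar>a * b\<bar> \<le> a\<^sup>2 + b\<^sup>2" for a b :: real
  proof -
    have "2 * (\<bar>a\<bar> * \<bar>b\<bar>) \<le> a\<^sup>2 + b\<^sup>2"
      using zero_le_power2[of "\<bar>a\<bar> - \<bar>b\<bar>"] by (simp add: power2_diff)
    moreover have "0 \<le> \<bar>a\<bar> * \<bar>b\<bar>" by simp
    ultimately show ?thesis unfolding abs_mult by linarith
  qed
  then show "AE \<omega> in M. norm (X i \<omega> * X j \<omega>) \<le> norm ((X i \<omega>)\<^sup>2 + (X j \<omega>)\<^sup>2)"
    by (intro AE_I2) simp
qed

text \<open>The part of \<open>W\<^sup>2\<close> that remains after the squares of the large summands are removed. It is not a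
function of \<open>W\<close> and may be negative.\<close>

definition core_weight :: "'a \<Rightarrow> real" where
  "core_weight \<omega> = (\<Sum>i=1..n. (X i \<omega>)\<^sup>2 * indicat_real {x. \<bar>x\<bar> \<le> 1} (X i \<omega>) + (\<Sum>j\<in>{1..n} - {i}. X i \<omega> * X j \<omega>))"

definition tail_weight :: "'a \<Rightarrow> real" where
  "tail_weight \<omega> = (\<Sum>i=1..n. (X i \<omega>)\<^sup>2 * indicat_real {x. \<bar>x\<bar> > 1} (X i \<omega>))"

lemma W_square: "(W \<omega>)\<^sup>2 = core_weight \<omega> + tail_weight \<omega>"
proof -
  have "(W \<omega>)\<^sup>2 = (\<Sum>i=1..n. \<Sum>j=1..n. X i \<omega> * X j \<omega>)"
    unfolding W_def power2_eq_square by (rule sum_product)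
  also have "\<dots> = (\<Sum>i=1..n. X i \<omega> * X i \<omega> + (\<Sum>j\<in>{1..n} - {i}. X i \<omega> * X j \<omega>))"
    by (intro sum.cong sum.remove) auto
  also have "\<dots> = core_weight \<omega> + tail_weight \<omega>"
    unfolding core_weight_def tail_weight_def sum.distrib[symmetric]
    by (intro sum.cong) (auto split: split_indicator simp: power2_eq_square)
  finally show ?thesis .
qed

lemma integrable_core_weight: "integrable M core_weight"
  unfolding core_weight_def[abs_def]
  by (intro Bochner_Integration.integrable_sum Bochner_Integration.integrable_add
      integrable_X[OF _ P.integrable_core2] integrable_product) auto

lemma integrable_tail_weight: "integrable M tail_weight"
  unfolding tail_weight_def[abs_def]
  by (intro Bochner_Integration.integrable_sum integrable_X[OF _ P.integrable_tail2])

lemma tail_weight_nonneg: "tail_weight \<omega> \<ge> 0"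
  unfolding tail_weight_def by (intro sum_nonneg) auto

lemma expectation_tail_weight: "expectation tail_weight = B2"
proof -
  have "expectation tail_weight = (\<Sum>i=1..n. LINT \<omega>|M. (X i \<omega>)\<^sup>2 * indicat_real {x. \<bar>x\<bar> > 1} (X i \<omega>))"
    unfolding tail_weight_def[abs_def]
    by (intro Bochner_Integration.integral_sum integrable_X[OF _ P.integrable_tail2])
  also have "\<dots> = (\<Sum>i=1..n. P.tail2)"
    unfolding P.tail2_def by (intro sum.cong integral_X) auto
  finally show ?thesis by (simp add: P.B2_eq)
qed

lemma core_weight_char:
  "(CLINT \<omega>|M. complex_of_real (core_weight \<omega>) * iexp (t * W \<omega>))
    = of_nat n * P.char2 t * char P t ^ (n - 1) + of_nat n * of_nat (n - 1) * (P.char1 t)\<^sup>2 * char P t ^ (n - 2)"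
proof -
  let ?q = "\<lambda>x. x\<^sup>2 * indicat_real {x. \<bar>x\<bar> \<le> 1} x"
  let ?e = "\<lambda>\<omega>. iexp (t * W \<omega>)"
  have one: "(CLINT \<omega>|M. complex_of_real (?q (X i \<omega>)) * ?e \<omega>) = P.char2 t * char P t ^ (n - 1)" if "i \<in> {1..n}" for i
    using integral_prod_times_iexp[OF P.integrable_core2, of "{i}" t] that by (simp add: P.char2_def)
  have two: "(CLINT \<omega>|M. complex_of_real (X i \<omega> * X j \<omega>) * ?e \<omega>) = (P.char1 t)\<^sup>2 * char P t ^ (n - 2)"
    if "i \<in> {1..n}" "j \<in> {1..n} - {i}" for i j
  proof -
    have "card {i, j} = 2" "(\<Prod>k\<in>{i, j}. X k \<omega>) = X i \<omega> * X j \<omega>" for \<omega> using that by auto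
    then show ?thesis
      using integral_prod_times_iexp[OF P.integrable_id, of "{i, j}" t] that by (simp only: P.char1_def) simp
  qed
  have int1: "integrable M (\<lambda>\<omega>. complex_of_real (?q (X i \<omega>)) * ?e \<omega>)" if "i \<in> {1..n}" for i
    by (intro integrable_weighted_iexp integrable_X[OF _ P.integrable_core2] that W_measurable)
  have int2: "integrable M (\<lambda>\<omega>. complex_of_real (X i \<omega> * X j \<omega>) * ?e \<omega>)" if "i \<in> {1..n}" "j \<in> {1..n} - {i}" for i j
    using that by (intro integrable_weighted_iexp integrable_product W_measurable) auto
  have "complex_of_real (core_weight \<omega>) * ?e \<omega> =
      (\<Sum>i=1..n. complex_of_real (?q (X i \<omega>)) * ?e \<omega> + (\<Sum>j\<in>{1..n} - {i}. complex_of_real (X i \<omega> * X j \<omega>) * ?e \<omega>))" for \<omega>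
    unfolding core_weight_def of_real_sum of_real_add sum_distrib_right distrib_right ..
  then have "(CLINT \<omega>|M. complex_of_real (core_weight \<omega>) * ?e \<omega>)
     = (CLINT \<omega>|M. \<Sum>i=1..n. complex_of_real (?q (X i \<omega>)) * ?e \<omega> + (\<Sum>j\<in>{1..n} - {i}. complex_of_real (X i \<omega> * X j \<omega>) * ?e \<omega>))"
    by (simp only:)
  also have "\<dots> = (\<Sum>i=1..n. CLINT \<omega>|M. complex_of_real (?q (X i \<omega>)) * ?e \<omega> + (\<Sum>j\<in>{1..n} - {i}. complex_of_real (X i \<omega> * X j \<omega>) * ?e \<omega>))"
    by (intro Bochner_Integration.integral_sum Bochner_Integration.integrable_add Bochner_Integration.integrable_sum int1 int2)
  also have "\<dots> = (\<Sum>i=1..n. (CLINT \<omega>|M. complex_of_real (?q (X i \<omega>)) * ?e \<omega>) + (\<Sum>j\<in>{1..n} - {i}. CLINT \<omega>|M. complex_of_real (X i \<omega> * X j \<omega>) * ?e \<omega>))"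
    by (intro sum.cong refl trans[OF Bochner_Integration.integral_add] arg_cong2[where f = "(+)"]
        Bochner_Integration.integral_sum Bochner_Integration.integrable_sum int1 int2)
  also have "\<dots> = (\<Sum>i=1..n. P.char2 t * char P t ^ (n - 1) + (\<Sum>j\<in>{1..n} - {i}. (P.char1 t)\<^sup>2 * char P t ^ (n - 2)))"
    by (intro sum.cong refl arg_cong2[where f = "(+)"] one two)
  also have "\<dots> = of_nat n * P.char2 t * char P t ^ (n - 1) + of_nat n * of_nat (n - 1) * (P.char1 t)\<^sup>2 * char P t ^ (n - 2)"
  proof -
    have "(\<Sum>j\<in>{1..n} - {i}. c) = of_nat (n - 1) * c" if "i \<in> {1..n}" for i and c :: complex
      using that by (simp only: sum_constant card_Diff_singleton card_atLeastAtMost diff_Suc_1 Suc_eq_plus1 add_diff_cancel_right')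
    then show ?thesis
      by (simp only: sum_constant card_atLeastAtMost distrib_left mult.assoc diff_Suc_1 Suc_eq_plus1 add_diff_cancel_right' cong: sum.cong)
  qed
  finally show ?thesis .
qed

lemma expectation_core_weight: "expectation core_weight = 1 - B2"
proof -
  have c2: "P.char2 0 = complex_of_real (1 / real n - B2 / real n)"
  proof -
    have "P.char2 0 = (CLINT x|P. complex_of_real (x\<^sup>2 * indicat_real {x. \<bar>x\<bar> \<le> 1} x))"
      unfolding P.char2_def by (simp only: mult_zero_left of_real_0 mult_zero_right exp_zero mult_1_right)
    then show ?thesis
      unfolding integral_complex_of_real P.core2_eq P.second_moment_eq P.tail2_eq .
  qed
  have c1: "P.char1 0 = 0" unfolding P.char1_def using P.mean_zero by simp
  have "complex_of_real (expectation core_weight) = of_nat n * P.char2 0"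
    using core_weight_char[of 0] by (simp add: c1 P.char_zero)
  also have "\<dots> = complex_of_real (real n * (1 / real n - B2 / real n))"
    unfolding c2 by simp
  finally have "expectation core_weight = real n * (1 / real n - B2 / real n)"
    by (simp only: of_real_eq_iff)
  then show ?thesis using P.n_pos by (simp add: right_diff_distrib)
qed

lemma W_moments:
  "integrable M W" "integrable M (\<lambda>\<omega>. (W \<omega>)\<^sup>2)" "expectation W = 0" "expectation (\<lambda>\<omega>. (W \<omega>)\<^sup>2) = 1"
proof -
  show "integrable M W"
    unfolding W_def[abs_def] by (intro Bochner_Integration.integrable_sum integrable_X[OF _ P.integrable_id])
  have "expectation W = (\<Sum>i=1..n. LINT \<omega>|M. X i \<omega>)"
    unfolding W_def[abs_def] by (intro Bochner_Integration.integral_sum integrable_X[OF _ P.integrable_id])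
  also have "\<dots> = 0"
    using integral_X[of _ "\<lambda>x. x"] P.mean_zero by (intro sum.neutral ballI) simp
  finally show "expectation W = 0" .
  show "integrable M (\<lambda>\<omega>. (W \<omega>)\<^sup>2)"
    unfolding W_square by (intro Bochner_Integration.integrable_add integrable_core_weight integrable_tail_weight)
  show "expectation (\<lambda>\<omega>. (W \<omega>)\<^sup>2) = 1"
    unfolding W_square using integrable_core_weight integrable_tail_weight
    by (simp add: expectation_core_weight expectation_tail_weight)
qed

lemma W_distribution_moments:
  "integrable (distr M borel W) (\<lambda>x. x)" "integrable (distr M borel W) (\<lambda>x. x\<^sup>2)"
  "(LINT x|distr M borel W. x) = 0" "(LINT x|distr M borel W. x\<^sup>2) = 1"
  using W_moments by (simp_all add: integrable_distr_eq integral_distr)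

lemma cdf_W_trivial: "\<bar>cdf (distr M borel W) z - cdf std_normal_distribution z\<bar> \<le> 2 / (1 + \<bar>z\<bar>)\<^sup>2"
  by (rule cdf_difference_trivial[OF real_distribution_W W_distribution_moments real_dist_normal_dist std_normal_moments])

text \<open>The two contributions are \<open>2 J \<le> 4.31 \<beta> / \<pi>\<close> from the characteristic functions and
\<open>20 \<beta> / (\<pi> \<surd>(2 \<pi>))\<close> from the cut-off \<open>T\<close>.\<close>

lemma cdf_W_uniform:
  assumes b: "B2 + B3 \<le> 11 / 200"
  shows "\<bar>cdf (distr M borel W) z - cdf std_normal_distribution z\<bar> \<le> 37 / 9 * (B2 + B3)"
proof -
  let ?b = "B2 + B3"
  define T where "T = 6 / (5 * ?b)"
  have b0: "?b > 0" by (rule P.beta_pos)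
  then have T: "T > 0" by (simp add: T_def)
  define c1 c3 where "c1 = B2 + B3 / 4" and "c3 = B3 / 36 + 3 / 20 * ?b\<^sup>2"
  have c0: "c1 \<ge> 0" "c3 \<ge> 0" using P.B2_nonneg P.B3_nonneg by (auto simp: c1_def c3_def)
  define g where "g t = (c1 * t + c3 * t ^ 3) * exp (- (6 / 25 * t\<^sup>2))" for t :: real
  \<comment> \<open>a primitive of \<open>g\<close>, nowhere positive, so that \<open>G T - G 0 \<le> - G 0\<close>\<close>
  define G where "G t = - (c1 * (25 / 12) + c3 * (25 / 12 * t\<^sup>2 + 625 / 72)) * exp (- (6 / 25 * t\<^sup>2))" for t :: real
  define J where "J = (G T - G 0) / pi"
  interpret N: real_distribution std_normal_distribution by (rule real_dist_normal_dist)
  have "\<bar>cdf (distr M borel W) z - cdf std_normal_distribution z\<bar> \<le> 2 * J + 24 * (1 / sqrt (2 * pi)) / (pi * T)"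
  proof (rule fejer_smoothing_inequality[OF real_distribution_W real_dist_normal_dist T])
    show "cdf std_normal_distribution y - cdf std_normal_distribution x \<le> 1 / sqrt (2 * pi) * (y - x)" if "x \<le> y" for x y
      by (rule cdf_density_lipschitz[OF real_dist_normal_dist _ std_normal_density_le _ that]) auto
    fix x
    have "\<bar>(LINT \<omega>|M. 1 * fejer_cdf (T * (x - W \<omega>))) - (LINT w|std_normal_distribution. 1 * fejer_cdf (T * (x - w)))\<bar> \<le> J"
      unfolding J_def
    proof (rule fejer_weighted_difference[where g = g])
      show "prob_space M" "prob_space std_normal_distribution" by unfold_locales
      show "(G has_real_derivative g t) (at t)" for t
        unfolding G_def g_def
        by (auto intro!: derivative_eq_intros simp: power2_eq_square power3_eq_cube field_simps)
      show "continuous_on {0..T} g" unfolding g_def by (intro continuous_intros)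
      show "(LINT \<omega>|M. 1) = (LINT \<omega>|std_normal_distribution. (1::real))"
        using prob_space N.prob_space by (simp del: N.space_eq_univ)
      fix t :: real assume t: "0 < t" "t \<le> T"
      have "(CLINT \<omega>|M. complex_of_real 1 * iexp (t * W \<omega>)) = char P t ^ n"
        using char_W[of t] by simp
      moreover have "(CLINT x|std_normal_distribution. complex_of_real 1 * iexp (t * x)) = exp (- (t\<^sup>2 / 2))"
        using char_std_normal_distribution[THEN fun_cong, of t] by (simp add: char_def)
      ultimately show "cmod ((CLINT \<omega>|M. complex_of_real 1 * iexp (t * W \<omega>)) - (CLINT x|std_normal_distribution. complex_of_real 1 * iexp (t * x))) \<le> t * g t"
        using P.char_power_approx_small[OF b t(1)] t(2) by (simp only: T_def g_def c1_def c3_def)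
    qed (use T in auto)
    then show "\<bar>(LINT w|distr M borel W. fejer_cdf (T * (x - w))) - (LINT w|std_normal_distribution. fejer_cdf (T * (x - w)))\<bar> \<le> J"
      by (subst integral_distr) (simp_all)
  qed simp
  also have "\<dots> \<le> 37 / 9 * ?b"
  proof -
    have "0 \<le> (c1 * (25 / 12) + c3 * (25 / 12 * T\<^sup>2 + 625 / 72)) * exp (- (6 / 25 * T\<^sup>2))"
      by (intro mult_nonneg_nonneg add_nonneg_nonneg c0) auto
    then have "G T \<le> 0" unfolding G_def mult_minus_left by linarith
    moreover have "- G 0 = c1 * (25 / 12) + c3 * (625 / 72)" by (simp add: G_def)
    moreover have "?b\<^sup>2 \<le> 11 / 200 * ?b"
      unfolding power2_eq_square using b b0 by (intro mult_right_mono) auto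
    moreover have "c1 * (25 / 12) + c3 * (625 / 72) \<le> 2155 / 1000 * ?b" if "?b\<^sup>2 \<le> 11 / 200 * ?b"
    proof -
      have "x * (25 / 12) + y / 4 * (25 / 12) + (y / 36 + 3 / 20 * s) * (625 / 72) \<le> 2155 / 1000 * (x + y)"
        if "s \<le> 11 / 200 * (x + y)" "0 \<le> x" "0 \<le> y" for x y s :: real
        using that by (simp add: field_simps)
      from this[OF that P.B2_nonneg P.B3_nonneg] show ?thesis
        by (simp only: c1_def c3_def distrib_right)
    qed
    ultimately have GG: "G T - G 0 \<le> 2155 / 1000 * ?b" by linarith
    have "24 * (1 / sqrt (2 * pi)) / (pi * T) = 20 * (1 / sqrt (2 * pi)) * ?b / pi"
    proof -
      have "24 * m / (pi * (6 / (5 * c))) = 20 * m * c / pi" if "c > 0" for m c :: real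
        using that by (simp add: field_simps)
      then show ?thesis unfolding T_def using b0 .
    qed
    also have "\<dots> \<le> 20 * (2 / 5 + 1 / 500) * ?b / pi"
      using b0 by (intro divide_right_mono mult_right_mono mult_left_mono inverse_sqrt_2pi_le) auto
    finally have "24 * (1 / sqrt (2 * pi)) / (pi * T) \<le> 20 * (2 / 5 + 1 / 500) * ?b / pi" .
    moreover have "J \<le> 2155 / 1000 * ?b / pi"
      unfolding J_def by (rule divide_right_mono[OF GG]) simp
    ultimately have "2 * J + 24 * (1 / sqrt (2 * pi)) / (pi * T)
        \<le> 2 * (2155 / 1000 * ?b / pi) + 20 * (2 / 5 + 1 / 500) * ?b / pi" by linarith
    also have "\<dots> = (2 * (2155 / 1000 * ?b) + 20 * (2 / 5 + 1 / 500) * ?b) / pi"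
      by (simp only: add_divide_distrib times_divide_eq_right)
    also have "\<dots> \<le> (37 / 9 * ?b * pi) / pi"
    proof (rule divide_right_mono)
      have "2 * (2155 / 1000 * c) + 20 * (2 / 5 + 1 / 500) * c \<le> 37 / 9 * c * (31 / 10)" if "c > 0" for c :: real
        using that by simp
      moreover have "37 / 9 * ?b * (31 / 10) \<le> 37 / 9 * ?b * pi"
        using pi_lower_bound b0 by (intro mult_left_mono) auto
      ultimately show "2 * (2155 / 1000 * ?b) + 20 * (2 / 5 + 1 / 500) * ?b \<le> 37 / 9 * ?b * pi"
        using b0 by (meson order_trans)
    qed simp
    finally show ?thesis by simp
  qed
  finally show ?thesis .
qed

text \<open>Esseen's inequality for \<open>x\<^sup>2 dF\<close> and \<open>x\<^sup>2 d\<Phi>\<close>, with \<open>tail_weight\<close> on one side and the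
constant \<open>\<beta>\<^sub>2\<close> on the other contributing at most \<open>\<beta>\<^sub>2\<close> to the smoothed difference.\<close>

lemma cdf_W_nonuniform:
  assumes b: "B2 + B3 \<le> 1 / 100" and z: "z \<noteq> 0"
  shows "\<bar>cdf (distr M borel W) z - cdf std_normal_distribution z\<bar> \<le> 220 * (B2 + B3) / z\<^sup>2"
proof -
  let ?b = "B2 + B3" and ?N = std_normal_distribution
  define T where "T = 1 / ?b"
  have b0: "?b > 0" by (rule P.beta_pos)
  then have T: "T > 0" by (simp add: T_def)
  interpret N: real_distribution ?N by (rule real_dist_normal_dist)
  let ?\<mu> = "density (distr M borel W) (\<lambda>x. ennreal (x\<^sup>2))" and ?\<nu> = "density ?N (\<lambda>x. ennreal (x\<^sup>2))"
  have \<mu>: "real_distribution ?\<mu>"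
    by (rule real_distribution_square_density[OF real_distribution_W W_distribution_moments(2,4)])
  have \<nu>: "real_distribution ?\<nu>"
    by (rule real_distribution_square_density[OF real_dist_normal_dist std_normal_moments(2,4)])
  define g where "g t = ?b * (1 / (1 + (t / 2)\<^sup>2) + (41 / 4 * t + 5 * t ^ 3 + 3 / 2 * t ^ 5) * exp (- (t\<^sup>2 / 4)))" for t :: real
  \<comment> \<open>a primitive of \<open>g\<close>\<close>
  define G where "G t = ?b * (2 * arctan (t / 2)
      - (41 / 2 + 5 * (2 * t\<^sup>2 + 8) + 3 / 2 * (2 * t ^ 4 + 16 * t\<^sup>2 + 64)) * exp (- (t\<^sup>2 / 4)))" for t :: real
  define J where "J = (G T - G 0) / pi + B2"
  have "\<bar>cdf ?\<mu> x - cdf ?\<nu> x\<bar> \<le> 2 * J + 24 * (1 / sqrt (2 * pi)) / (pi * T)" for x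
  proof (rule fejer_smoothing_inequality[OF \<mu> \<nu> T])
    show "cdf ?\<nu> y - cdf ?\<nu> x \<le> 1 / sqrt (2 * pi) * (y - x)" if "x \<le> y" for x y
      using \<nu> that unfolding square_density_std_normal
      by (intro cdf_density_lipschitz square_std_normal_density_le) auto
    fix x
    have K: "0 \<le> fejer_cdf u" "fejer_cdf u \<le> 1" for u by (rule fejer_cdf_bounds)+
    let ?K = "\<lambda>w. fejer_cdf (T * (x - w))"
    have intK: "integrable M' (\<lambda>\<omega>. f \<omega> * ?K (Y \<omega>))" if "integrable M' f" "Y \<in> borel_measurable M'" for M' and f Y :: "'c \<Rightarrow> real"
      using that(1) by (rule Bochner_Integration.integrable_bound)
        (use that in \<open>auto simp: abs_mult K intro!: mult_left_le\<close>)
    have main: "\<bar>(LINT \<omega>|M. core_weight \<omega> * ?K (W \<omega>)) - (LINT w|?N. (w\<^sup>2 - B2) * ?K w)\<bar> \<le> (G T - G 0) / pi"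
    proof (rule fejer_weighted_difference[where g = g])
      show "prob_space M" "prob_space ?N" by unfold_locales
      show "integrable M core_weight" by (rule integrable_core_weight)
      show "integrable ?N (\<lambda>w. w\<^sup>2 - B2)"
        by (intro Bochner_Integration.integrable_diff std_normal_moments N.integrable_const)
      show "expectation core_weight = (LINT w|?N. w\<^sup>2 - B2)"
        using std_normal_moments N.prob_space by (simp add: expectation_core_weight del: N.space_eq_univ)
      show "(G has_real_derivative g t) (at t)" for t
      proof -
        have d1: "((\<lambda>t. 2 * arctan (t / 2)) has_real_derivative 1 / (1 + (t / 2)\<^sup>2)) (at t)"
        proof -
          have "((\<lambda>t. 2 * arctan (t / 2)) has_real_derivative 2 * (inverse (1 + (t / 2)\<^sup>2) * (1 / 2))) (at t)"
            by (rule DERIV_cmult, rule DERIV_chain2[OF DERIV_arctan]) (auto intro!: derivative_eq_intros)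
          moreover have "2 * (inverse s * (1 / 2)) = 1 / s" for s :: real
            by (simp add: inverse_eq_divide)
          ultimately show ?thesis by (simp only:)
        qed
        have d2: "((\<lambda>t. (41 / 2 + 5 * (2 * t\<^sup>2 + 8) + 3 / 2 * (2 * t ^ 4 + 16 * t\<^sup>2 + 64)) * exp (- (t\<^sup>2 / 4)))
          has_real_derivative - ((41 / 4 * t + 5 * t ^ 3 + 3 / 2 * t ^ 5) * exp (- (t\<^sup>2 / 4)))) (at t)"
          by (auto intro!: derivative_eq_intros simp: eval_nat_numeral field_simps)
        show ?thesis
          using DERIV_cmult[OF DERIV_diff[OF d1 d2], of ?b]
          unfolding G_def[abs_def] g_def diff_minus_eq_add .
      qed
      show "continuous_on {0..T} g" unfolding g_def
        by (intro continuous_intros) (auto simp: add_nonneg_eq_0_iff)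
      fix t :: real assume t: "0 < t" "t \<le> T"
      have "(CLINT w|?N. complex_of_real (w\<^sup>2 - B2) * iexp (t * w)) = (1 - t\<^sup>2) * exp (- (t\<^sup>2 / 2)) - B2 * exp (- (t\<^sup>2 / 2))"
      proof -
        have "complex_of_real (w\<^sup>2 - B2) * iexp (t * w) = complex_of_real (w\<^sup>2) * iexp (t * w) - B2 * iexp (t * w)" for w
          by (simp only: of_real_diff left_diff_distrib)
        then have "(CLINT w|?N. complex_of_real (w\<^sup>2 - B2) * iexp (t * w))
           = (CLINT w|?N. complex_of_real (w\<^sup>2) * iexp (t * w) - B2 * iexp (t * w))" by (simp only:)
        also have "\<dots> = (CLINT w|?N. complex_of_real (w\<^sup>2) * iexp (t * w)) - (CLINT w|?N. B2 * iexp (t * w))"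
          by (intro Bochner_Integration.integral_diff N.integrable_weighted_iexp
              Bochner_Integration.integrable_diff std_normal_moments N.integrable_const measurable_ident_sets) simp_all
        also have "(CLINT w|?N. B2 * iexp (t * w)) = B2 * char ?N t"
          unfolding char_def by (rule integral_mult_right_zero)
        also have "char ?N t = exp (- (t\<^sup>2 / 2))" by (simp add: char_std_normal_distribution)
        finally show ?thesis unfolding std_normal_square_char by simp
      qed
      also have "\<dots> = (1 - B2 - t\<^sup>2) * exp (- (t\<^sup>2 / 2))" by (simp add: algebra_simps)
      finally have "cmod ((CLINT \<omega>|M. complex_of_real (core_weight \<omega>) * iexp (t * W \<omega>)) - (CLINT w|?N. complex_of_real (w\<^sup>2 - B2) * iexp (t * w)))
        \<le> t * (?b * ((1 + 9 * t + 5 / 2 * t\<^sup>2 + 3 * t ^ 3 + t ^ 4 + t ^ 5) * exp (- (t\<^sup>2 / 4))))"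
        unfolding core_weight_char using P.weighted_char_approx_small[OF b t(1)] t(2) by (simp only: T_def)
      also have "\<dots> \<le> t * g t"
      proof -
        let ?E = "exp (- (t\<^sup>2 / 4))"
        have E: "?E \<le> 1 / (1 + (t / 2)\<^sup>2)"
        proof -
          have "1 + (t / 2)\<^sup>2 \<le> exp (t\<^sup>2 / 4)"
            using exp_ge_add_one_self[of "t\<^sup>2 / 4"] by (simp add: power_divide)
          then have "inverse (exp (t\<^sup>2 / 4)) \<le> inverse (1 + (t / 2)\<^sup>2)"
            by (intro le_imp_inverse_le) (auto simp: add_pos_nonneg)
          then show ?thesis by (simp add: exp_minus inverse_eq_divide)
        qed
        \<comment> \<open>even powers are again traded for odd ones; the constant term goes into the arctangent part\<close>
        have "0 \<le> t * (t - 1)\<^sup>2" "0 \<le> t ^ 3 * (t - 1)\<^sup>2" using t by simp_all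
        then have a: "t\<^sup>2 \<le> (t + t ^ 3) / 2" "t ^ 4 \<le> (t ^ 3 + t ^ 5) / 2"
          by (simp_all add: eval_nat_numeral algebra_simps)
        have "0 \<le> t ^ 3" using t by simp
        have lin: "9 * t + 5 / 2 * u + 3 * v + w + y \<le> 41 / 4 * t + 5 * v + 3 / 2 * y"
          if "u \<le> (t + v) / 2" "w \<le> (v + y) / 2" "0 \<le> v" for u v w y :: real
          using that by (simp add: field_simps)
        have "9 * t + 5 / 2 * t\<^sup>2 + 3 * t ^ 3 + t ^ 4 + t ^ 5 \<le> 41 / 4 * t + 5 * t ^ 3 + 3 / 2 * t ^ 5"
          by (rule lin[OF a \<open>0 \<le> t ^ 3\<close>])
        then have "(9 * t + 5 / 2 * t\<^sup>2 + 3 * t ^ 3 + t ^ 4 + t ^ 5) * ?E \<le> (41 / 4 * t + 5 * t ^ 3 + 3 / 2 * t ^ 5) * ?E"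
          by (rule mult_right_mono) simp
        with E have "1 * ?E + (9 * t + 5 / 2 * t\<^sup>2 + 3 * t ^ 3 + t ^ 4 + t ^ 5) * ?E
            \<le> 1 / (1 + (t / 2)\<^sup>2) + (41 / 4 * t + 5 * t ^ 3 + 3 / 2 * t ^ 5) * ?E" by linarith
        then have "(1 + 9 * t + 5 / 2 * t\<^sup>2 + 3 * t ^ 3 + t ^ 4 + t ^ 5) * ?E
            \<le> 1 / (1 + (t / 2)\<^sup>2) + (41 / 4 * t + 5 * t ^ 3 + 3 / 2 * t ^ 5) * ?E"
          by (simp only: distrib_right add.assoc)
        then show ?thesis
          unfolding g_def using t b0 by (intro mult_left_mono) auto
      qed
      finally show "cmod ((CLINT \<omega>|M. complex_of_real (core_weight \<omega>) * iexp (t * W \<omega>)) - (CLINT w|?N. complex_of_real (w\<^sup>2 - B2) * iexp (t * w)))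
        \<le> t * g t" .
    qed (use T in auto)
    have "(LINT w|?\<mu>. ?K w) = (LINT w|distr M borel W. w\<^sup>2 * ?K w)"
      by (rule integral_square_density[OF real_distribution_W]) simp
    also have "\<dots> = (LINT \<omega>|M. (W \<omega>)\<^sup>2 * ?K (W \<omega>))"
      by (rule integral_distr) simp_all
    also have "\<dots> = (LINT \<omega>|M. core_weight \<omega> * ?K (W \<omega>) + tail_weight \<omega> * ?K (W \<omega>))"
      unfolding W_square distrib_right ..
    also have "\<dots> = (LINT \<omega>|M. core_weight \<omega> * ?K (W \<omega>)) + (LINT \<omega>|M. tail_weight \<omega> * ?K (W \<omega>))"
      by (intro Bochner_Integration.integral_add intK integrable_core_weight integrable_tail_weight W_measurable)
    finally have e1: "(LINT w|?\<mu>. ?K w) = (LINT \<omega>|M. core_weight \<omega> * ?K (W \<omega>)) + (LINT \<omega>|M. tail_weight \<omega> * ?K (W \<omega>))" .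
    have "(LINT w|?\<nu>. ?K w) = (LINT w|?N. w\<^sup>2 * ?K w)"
      by (rule integral_square_density[OF real_dist_normal_dist]) simp
    also have "\<dots> = (LINT w|?N. (w\<^sup>2 - B2) * ?K w + B2 * ?K w)"
      by (simp add: algebra_simps)
    also have "\<dots> = (LINT w|?N. (w\<^sup>2 - B2) * ?K w) + (LINT w|?N. B2 * ?K w)"
      by (intro Bochner_Integration.integral_add intK Bochner_Integration.integrable_diff std_normal_moments N.integrable_const) simp_all
    finally have e2: "(LINT w|?\<nu>. ?K w) = (LINT w|?N. (w\<^sup>2 - B2) * ?K w) + (LINT w|?N. B2 * ?K w)" .
    have "(LINT \<omega>|M. tail_weight \<omega> * ?K (W \<omega>)) \<le> (LINT \<omega>|M. tail_weight \<omega>)"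
      by (intro integral_mono intK integrable_tail_weight W_measurable mult_left_le K tail_weight_nonneg)
    moreover have "0 \<le> (LINT \<omega>|M. tail_weight \<omega> * ?K (W \<omega>))"
      by (intro Bochner_Integration.integral_nonneg mult_nonneg_nonneg K tail_weight_nonneg)
    moreover have "(LINT w|?N. B2 * ?K w) \<le> (LINT w|?N. B2)"
      by (intro integral_mono intK N.integrable_const mult_left_le K P.B2_nonneg) simp
    moreover have "(LINT w|?N. B2) = B2" using N.prob_space by (simp del: N.space_eq_univ)
    moreover have "0 \<le> (LINT w|?N. B2 * ?K w)"
      by (intro Bochner_Integration.integral_nonneg mult_nonneg_nonneg K P.B2_nonneg)
    ultimately show "\<bar>(LINT w|?\<mu>. ?K w) - (LINT w|?\<nu>. ?K w)\<bar> \<le> J"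
      using main unfolding e1 e2 J_def expectation_tail_weight by linarith
  qed simp
  moreover have "2 * J + 24 * (1 / sqrt (2 * pi)) / (pi * T) \<le> 110 * ?b"
  proof -
    have "2 * arctan (T / 2) \<le> pi" using arctan_ubound[of "T / 2"] by linarith
    moreover have "0 \<le> (41 / 2 + 5 * (2 * T\<^sup>2 + 8) + 3 / 2 * (2 * T ^ 4 + 16 * T\<^sup>2 + 64)) * exp (- (T\<^sup>2 / 4))"
      by (intro mult_nonneg_nonneg add_nonneg_nonneg) auto
    ultimately have "?b * (2 * arctan (T / 2) - (41 / 2 + 5 * (2 * T\<^sup>2 + 8) + 3 / 2 * (2 * T ^ 4 + 16 * T\<^sup>2 + 64)) * exp (- (T\<^sup>2 / 4))) \<le> ?b * pi"
      using b0 by (intro mult_left_mono) linarith+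
    then have "G T \<le> ?b * pi" by (simp only: G_def)
    moreover have "- G 0 = ?b * (313 / 2)" by (simp add: G_def)
    ultimately have "G T - G 0 \<le> ?b * (pi + 313 / 2)"
      unfolding distrib_left[of ?b] by linarith
    also have "\<dots> \<le> ?b * (52 * pi)"
      using pi_lower_bound b0 by (intro mult_left_mono) auto
    finally have "(G T - G 0) / pi \<le> 52 * ?b" by (simp add: pos_divide_le_eq mult.commute mult.left_commute)
    then have "J \<le> 52 * ?b + B2" unfolding J_def by (rule add_right_mono)
    moreover have "24 * (1 / sqrt (2 * pi)) / (pi * T) \<le> 4 * ?b"
    proof -
      have "24 * (1 / sqrt (2 * pi)) / (pi * T) = 24 * (1 / sqrt (2 * pi)) * ?b / pi"
        by (simp add: T_def)
      also have "\<dots> \<le> 24 * (2 / 5 + 1 / 500) * ?b / pi"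
        using b0 by (intro divide_right_mono mult_right_mono mult_left_mono inverse_sqrt_2pi_le) auto
      also have "\<dots> \<le> (4 * ?b * pi) / pi"
        using mult_left_mono[OF less_imp_le[OF pi_lower_bound], of "4 * ?b"] b0
        by (intro divide_right_mono) auto
      finally show ?thesis by simp
    qed
    moreover have "2 * j + k \<le> 110 * (x + y)"
      if "j \<le> 52 * (x + y) + x" "k \<le> 4 * (x + y)" "0 \<le> y" for j k x y :: real
      using that by (simp add: algebra_simps)
    ultimately show ?thesis using P.B3_nonneg by blast
  qed
  ultimately have "\<bar>cdf (distr M borel W) z - cdf ?N z\<bar> \<le> 2 * (110 * ?b) / z\<^sup>2"
    by (intro cdf_difference_from_square_density[OF real_distribution_W W_distribution_moments(2,4)
        real_dist_normal_dist std_normal_moments(2,4) _ z]) (meson order_trans)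
  then show ?thesis by simp
qed

end

section \<open>The non-uniform bound\<close>

theorem theorem3p3:
  fixes M :: "'a measure" and \<xi> :: "nat \<Rightarrow> 'a \<Rightarrow> real" and n :: nat
    and W :: "'a \<Rightarrow> real" and \<beta>\<^sub>2 \<beta>\<^sub>3 :: real
  assumes prob: "prob_space M"
    and n: "n \<ge> 1"
    and indep: "prob_space.indep_vars M (\<lambda>_. borel) \<xi> {1..n}"
    and ident: "\<And>i j. i \<in> {1..n} \<Longrightarrow> j \<in> {1..n} \<Longrightarrow> distr M borel (\<xi> i) = distr M borel (\<xi> j)"
    and int: "\<And>i. i \<in> {1..n} \<Longrightarrow> integrable M (\<xi> i)"
    and mean: "\<And>i. i \<in> {1..n} \<Longrightarrow> (LINT \<omega>|M. \<xi> i \<omega>) = 0"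
    and sq_int: "\<And>i. i \<in> {1..n} \<Longrightarrow> integrable M (\<lambda>\<omega>. (\<xi> i \<omega>)\<^sup>2)"
    and var: "(\<Sum>i=1..n. LINT \<omega>|M. (\<xi> i \<omega>)\<^sup>2) = 1"
    and W: "W = (\<lambda>\<omega>. \<Sum>i=1..n. \<xi> i \<omega>)"
    and \<beta>\<^sub>2: "\<beta>\<^sub>2 = trunc_beta2 M \<xi> n"
    and \<beta>\<^sub>3: "\<beta>\<^sub>3 = trunc_beta3 M \<xi> n"
  shows "\<forall>z::real.
    \<bar>\<P>(\<omega> in M. W \<omega> \<le> z) - cdf std_normal_distribution z\<bar>
      \<le> 2 * (\<Sum>i=1..n. \<P>(\<omega> in M. \<bar>\<xi> i \<omega>\<bar> > max 1 \<bar>z\<bar> / 4))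
        + C2_bound (\<beta>\<^sub>2 + \<beta>\<^sub>3) z * (1 / (1 + \<bar>z\<bar>)\<^sup>2) * (\<beta>\<^sub>2 + \<beta>\<^sub>3)"
proof (intro allI)
  fix z :: real
  interpret prob_space M by (rule prob)
  define P where "P = distr M borel (\<xi> 1)"
  have one: "1 \<in> {1..n}" using n by simp
  have meas: "\<xi> i \<in> borel_measurable M" if "i \<in> {1..n}" for i
    using int[OF that] by simp
  have distr: "distr M borel (\<xi> i) = P" if "i \<in> {1..n}" for i
    unfolding P_def by (rule ident[OF that one])
  have transfer: "(LINT \<omega>|M. f (\<xi> i \<omega>)) = (LINT x|P. f x)"
    if "i \<in> {1..n}" "f \<in> borel_measurable borel" for i and f :: "real \<Rightarrow> real"
    unfolding distr[OF that(1), symmetric] using that meas[OF that(1)] by (subst integral_distr) auto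
  have P: "centered_distribution P"
  proof -
    have "real_distribution P"
      unfolding P_def by (rule real_distribution_distr[OF meas[OF one]])
    moreover have "integrable P (\<lambda>x. x)" "integrable P (\<lambda>x. x\<^sup>2)"
      unfolding P_def using int[OF one] sq_int[OF one] meas[OF one] by (simp_all add: integrable_distr_eq)
    moreover have "(LINT x|P. x) = 0"
      using transfer[OF one, of "\<lambda>x. x"] mean[OF one] by simp
    ultimately show ?thesis
      by (simp add: centered_distribution_def centered_distribution_axioms_def)
  qed
  interpret P: centered_distribution P by (rule P)
  have "(\<Sum>i=1..n. LINT \<omega>|M. (\<xi> i \<omega>)\<^sup>2) = (\<Sum>i=1..n. P.second_moment)"
    unfolding P.second_moment_def by (intro sum.cong refl transfer) auto
  then have v: "real n * P.second_moment = 1" using var by simp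
  have b2: "\<beta>\<^sub>2 = real n * P.tail2"
  proof -
    have "\<beta>\<^sub>2 = (\<Sum>i=1..n. LINT \<omega>|M. (\<xi> i \<omega>)\<^sup>2 * indicat_real {x. \<bar>x\<bar> > 1} (\<xi> i \<omega>))"
      unfolding \<beta>\<^sub>2 trunc_beta2_def by (simp add: indicator_def)
    also have "\<dots> = (\<Sum>i=1..n. P.tail2)"
      unfolding P.tail2_def by (intro sum.cong refl transfer) auto
    finally show ?thesis by simp
  qed
  have b3: "\<beta>\<^sub>3 = real n * P.core3"
  proof -
    have "\<beta>\<^sub>3 = (\<Sum>i=1..n. LINT \<omega>|M. \<bar>\<xi> i \<omega>\<bar> ^ 3 * indicat_real {x. \<bar>x\<bar> \<le> 1} (\<xi> i \<omega>))"
      unfolding \<beta>\<^sub>3 trunc_beta3_def by (simp add: indicator_def)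
    also have "\<dots> = (\<Sum>i=1..n. P.core3)"
      unfolding P.core3_def by (intro sum.cong refl transfer) auto
    finally show ?thesis by simp
  qed
  interpret S: iid_summands M P n \<beta>\<^sub>2 \<beta>\<^sub>3 \<xi>
    by unfold_locales (use v b2 b3 indep distr in auto)
  have W_eq: "W = S.W" by (simp add: W S.W_def fun_eq_iff)
  let ?b = "\<beta>\<^sub>2 + \<beta>\<^sub>3"
  let ?D = "\<bar>cdf (distr M borel S.W) z - cdf std_normal_distribution z\<bar>"
  have D: "\<bar>\<P>(\<omega> in M. W \<omega> \<le> z) - cdf std_normal_distribution z\<bar> = ?D"
  proof -
    have "cdf (distr M borel S.W) z = measure M (S.W -` {..z} \<inter> space M)"
      unfolding cdf_def by (rule measure_distr) auto
    also have "S.W -` {..z} \<inter> space M = {\<omega> \<in> space M. W \<omega> \<le> z}"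
      by (auto simp: W_eq)
    finally show ?thesis by simp
  qed
  have b0: "?b > 0" by (rule S.P.beta_pos)
  have q: "(1 + \<bar>z\<bar>)\<^sup>2 > 0" by (intro zero_less_power) simp
  have "?D * (1 + \<bar>z\<bar>)\<^sup>2 \<le> C2_bound ?b z * ?b"
  proof (cases "C2_bound ?b z * ?b \<ge> 2")
    case True
    have "?D * (1 + \<bar>z\<bar>)\<^sup>2 \<le> 2"
      using S.cdf_W_trivial[of z] q by (simp add: pos_le_divide_eq)
    with True show ?thesis by linarith
  next
    case False
    then have b1: "?b < 1" by (auto simp: C2_bound_def split: if_splits)
    show ?thesis
    proof (cases "\<bar>z\<bar> \<le> 2")
      case True
      then have C: "C2_bound ?b z = 37" using b1 by (simp add: C2_bound_def)
      have "?D \<le> 37 / 9 * ?b"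
        using False by (intro S.cdf_W_uniform) (simp add: C)
      moreover have "(1 + \<bar>z\<bar>)\<^sup>2 \<le> 3\<^sup>2" using True by (intro power_mono) auto
      ultimately have "?D * (1 + \<bar>z\<bar>)\<^sup>2 \<le> (37 / 9 * ?b) * 3\<^sup>2"
        using b0 by (intro mult_mono) auto
      then show ?thesis by (simp add: C)
    next
      case big: False
      then have C: "C2_bound ?b z = 25431" using b1 by (simp add: C2_bound_def)
      have z: "z \<noteq> 0" using big by auto
      have "?D \<le> 220 * ?b / z\<^sup>2"
        using False by (intro S.cdf_W_nonuniform z) (simp add: C)
      moreover have "(1 + \<bar>z\<bar>)\<^sup>2 \<le> (3 / 2 * \<bar>z\<bar>)\<^sup>2" using big by (intro power_mono) auto
      ultimately have "?D * (1 + \<bar>z\<bar>)\<^sup>2 \<le> (220 * ?b / z\<^sup>2) * (3 / 2 * \<bar>z\<bar>)\<^sup>2"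
        using b0 by (intro mult_mono) auto
      also have "\<dots> = 495 * ?b" using z by (simp add: power_mult_distrib power2_eq_square)
      finally show ?thesis using b0 by (simp add: C)
    qed
  qed
  then have "?D \<le> C2_bound ?b z * ?b / (1 + \<bar>z\<bar>)\<^sup>2"
    using q by (simp add: pos_le_divide_eq)
  moreover have "0 \<le> 2 * (\<Sum>i=1..n. \<P>(\<omega> in M. \<bar>\<xi> i \<omega>\<bar> > max 1 \<bar>z\<bar> / 4))"
    by (intro mult_nonneg_nonneg sum_nonneg) auto
  ultimately show "\<bar>\<P>(\<omega> in M. W \<omega> \<le> z) - cdf std_normal_distribution z\<bar>
      \<le> 2 * (\<Sum>i=1..n. \<P>(\<omega> in M. \<bar>\<xi> i \<omega>\<bar> > max 1 \<bar>z\<bar> / 4))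
        + C2_bound ?b z * (1 / (1 + \<bar>z\<bar>)\<^sup>2) * ?b"
    unfolding D by simp
qed

end
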